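(* Let $n\ge 1$, $T=\{0,1,\dots,n\}$, and let real numbers $\mu_0$, $\sigma_0>0$; $c_t,d_t$, $q_t>0$ $(0\le t\le n)$; $a_t,b_t$, $r_t>0$ $(1\le t\le n)$ be given. Consider the linear Gaussian sequential causal observable (with state spaces $\Omega_t=\mathbb{R}$, observables $F_t$, causal operators $\Phi^{t-1,t}$) and the Gaussian initial state $\rho_0$ determined by these parameters as described in the context. Let $(x_0,x_1,\dots,x_n)\in\mathbb{R}^{n+1}$ be a measured value and fix $s\in T$. Define forward quantities recursively, starting from $\mu_0,\sigma_0^2$, by $$\widetilde\sigma_{t-1}^2=\frac{q_{t-1}^2\sigma_{t-1}^2}{q_{t-1}^2+c_{t-1}^2\sigma_{t-1}^2},\qquad \widetilde\mu_{t-1}=\mu_{t-1}+\widetilde\sigma_{t-1}^2\,\frac{c_{t-1}}{q_{t-1}^2}\,(x_{t-1}-d_{t-1}-c_{t-1}\mu_{t-1}),$$ $$\sigma_t^2=a_t^2\widetilde\sigma_{t-1}^2+r_t^2,\qquad \mu_t=a_t\widetilde\mu_{t-1}+b_t\qquad(t=1,\dots,s),$$ and put $$\rho_s(\omega)=\frac{1}{\sqrt{2\pi}\,\sigma_s}\exp\Big[-\frac{(\omega-\mu_s)^2}{2\sigma_s^2}\Big].$$ Define backward quantities recursively, starting from $$\widetilde u_n=\frac{c_n}{q_n},\qquad \widetilde v_n=\frac{x_n-d_n}{q_n},$$ by, for $t=n,n-1,\dots,s+1$, $$u_{t-1}=-\frac{a_t\widetilde u_t}{\sqrt{1+r_t^2\widetilde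 u_t^2}},\qquad v_{t-1}=\frac{b_t\widetilde u_t-\widetilde v_t}{\sqrt{1+r_t^2\widetilde u_t^2}},$$ $$\widetilde u_{t-1}=\frac{\sqrt{c_{t-1}^2+u_{t-1}^2q_{t-1}^2}}{q_{t-1}},\qquad \widetilde v_{t-1}=\frac{c_{t-1}(x_{t-1}-d_{t-1})+u_{t-1}v_{t-1}q_{t-1}^2}{q_{t-1}\sqrt{c_{t-1}^2+u_{t-1}^2q_{t-1}^2}}$$ (with the convention $\widetilde v_{t-1}=0$ if $c_{t-1}=u_{t-1}=0$), and put $$\widetilde f_{x_s}(\omega)=\exp\Big[-\tfrac12\big(\widetilde u_s\,\omega-\widetilde v_s\big)^2\Big].$$ Then the Bayes–Kalman operator at the measured value $(x_0,\dots,x_n)$, applied to $\rho_0$, is given by $$\Big([B^s_{\widehat{\mathsf O}_0}(\{x_0\}\times\cdots\times\{x_n\})]\rho_0\Big)(\omega_s)=\frac{\widetilde f_{x_s}(\omega_s)\,\rho_s(\omega_s)}{\int_{-\infty}^{\infty}\widetilde f_{x_s}(\omega)\,\rho_s(\omega)\,d\omega}\qquad(\omega_s\in\mathbb{R}).$$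
   Context: All state spaces are $\Omega_t=\mathbb{R}$ with Lebesgue measure, $t\in T=\{0,\dots,n\}$. Write $L^1_{+1}(\Omega_t)=\{\rho\in L^1(\mathbb{R}):\rho\ge 0,\ \int\rho\,d\omega=1\}$ (mixed states). Observable: an observable $(Y,\mathcal G,G)$ in $L^\infty(\Omega_t)$ consists of a set $Y$, a $\sigma$-field $\mathcal G$ on $Y$ and a map $G:\mathcal G\to L^\infty(\Omega_t)$ with $0\le G(\Gamma)\le 1$, $G(\emptyset)=0$, $G(Y)=1$, countably additive in the weak$^*$ topology of $L^\infty(\Omega_t)=L^1(\Omega_t)^*$. Initial state: $\rho_0(\omega_0)=\frac{1}{\sqrt{2\pi}\sigma_0}\exp\big[-\frac{(\omega_0-\mu_0)^2}{2\sigma_0^2}\big]$. Observable at time $t$: $\mathsf O_t=(\mathbb{R},\mathcal B_{\mathbb{R}},F_t)$, where $\mathcal B_{\mathbb R}$ is the Borel $\sigma$-field and $$[F_t(\Xi)](\omega_t)=\int_{\Xi}\frac{1}{\sqrt{2\pi}q_t}\exp\Big[-\frac{(x-c_t\omega_t-d_t)^2}{2q_t^2}\Big]dx .$$ Causal operator $\Phi^{t-1,t}:L^\infty(\Omega_t)\to L^\infty(\Omega_{t-1})$, $t=1,\dots,n$: $$[\Phi^{t-1,t}f](\omega_{t-1})=\int_{-\infty}^\infty\frac{1}{\sqrt{2\pi}r_t}\exp\Big[-\frac{(\omega_t-a_t\omega_{t-1}-b_t)^2}{2r_t^2}\Big]f(\omega_t)\,d\omega_t .$$ Realization $\widehat{\mathsf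 O}_0$: the observable in $L^\infty(\Omega_0)$ with value space $\mathbb{R}^{n+1}$ given on rectangles $\Xi_0\times\cdots\times\Xi_n$ by $\widehat F_0(\Xi_0\times\cdots\times\Xi_n)$, where $\widehat F_n(\Xi_n)=F_n(\Xi_n)$ and $\widehat F_t(\Xi_t\times\cdots\times\Xi_n)=F_t(\Xi_t)\cdot\Phi^{t,t+1}\widehat F_{t+1}(\Xi_{t+1}\times\cdots\times\Xi_n)$ for $t<n$. For an observable $(Y,\mathcal G,G)$ in $L^\infty(\Omega_s)$ and $\Gamma\in\mathcal G$, let $\widehat H_0(\Xi_0\times\cdots\times\Xi_n;\Gamma)\in L^\infty(\Omega_0)$ be obtained by the same recursion with $F_s(\Xi_s)$ replaced by $F_s(\Xi_s)\cdot G(\Gamma)$. Bayes–Kalman operator: for Borel sets $\Xi_0,\dots,\Xi_n$ with $\int\widehat F_0(\Xi_0\times\cdots\times\Xi_n)\rho_0\,d\omega_0>0$, $[B^s_{\widehat{\mathsf O}_0}(\Xi_0\times\cdots\times\Xi_n)](\rho_0)$ is the unique $\rho_s^a\in L^1_{+1}(\Omega_s)$ such that $$\frac{\int_{\Omega_0}[\widehat H_0(\Xi_0\times\cdots\times\Xi_n;\Gamma)](\omega_0)\rho_0(\omega_0)\,d\omega_0}{\int_{\Omega_0}[\widehat F_0(\Xi_0\times\cdots\times\Xi_n)](\omega_0)\rho_0(\omega_0)\,d\omega_0}=\int_{\Omega_s}[G(\Gamma)](\omega_s)\,\rho_s^a(\omega_s)\,d\omega_s$$ for every observable $(Y,\mathcal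 G,G)$ in $L^\infty(\Omega_s)$ and every $\Gamma\in\mathcal G$. At a point: $[B^s_{\widehat{\mathsf O}_0}(\{x_0\}\times\cdots\times\{x_n\})](\rho_0)$ denotes $\lim_{\Xi_t\to x_t\,(t\in T)}[B^s_{\widehat{\mathsf O}_0}(\Xi_0\times\cdots\times\Xi_n)](\rho_0)$, where each $\Xi_t$ runs over intervals of positive length containing $x_t$ with length tending to $0$, and the limit is understood in the sense that it is the element $\rho\in L^1_{+1}(\Omega_s)$ for which the left-hand ratio above converges to $\int_{\Omega_s}[G(\Gamma)](\omega_s)\rho(\omega_s)\,d\omega_s$ for every observable $(Y,\mathcal G,G)$ in $L^\infty(\Omega_s)$ and every $\Gamma\in\mathcal G$. *)

theory Defs
  imports "HOL-Probability.Probability"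
begin

(* Elements of L^1 and L^infinity of the real line are represented by real functions measurable
   with respect to the (complete) Lebesgue measure; equality of classes is equality a.e. *)

definition mixed_state :: "(real \<Rightarrow> real) \<Rightarrow> bool" where
  "mixed_state \<rho> \<longleftrightarrow>
     integrable lebesgue \<rho> \<and> (AE \<omega> in lebesgue. 0 \<le> \<rho> \<omega>) \<and> (LINT \<omega>|lebesgue. \<rho> \<omega>) = 1"

(* The last conjunct is countable additivity in the weak* topology of L^infinity = (L^1)*. *)
definition observable :: "'y set \<Rightarrow> 'y set set \<Rightarrow> ('y set \<Rightarrow> real \<Rightarrow> real) \<Rightarrow> bool" where
  "observable Y \<G> G \<longleftrightarrow>
     sigma_algebra Y \<G> \<and>
     (\<forall>\<Gamma>\<in>\<G>. G \<Gamma> \<in> borel_measurable lebesgue \<and>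
             (AE \<omega> in lebesgue. 0 \<le> G \<Gamma> \<omega> \<and> G \<Gamma> \<omega> \<le> 1)) \<and>
     (AE \<omega> in lebesgue. G {} \<omega> = 0) \<and>
     (AE \<omega> in lebesgue. G Y \<omega> = 1) \<and>
     (\<forall>A. range A \<subseteq> \<G> \<and> disjoint_family A \<longrightarrow>
        (\<forall>\<rho>. integrable lebesgue \<rho> \<longrightarrow>
           (\<lambda>i::nat. LINT \<omega>|lebesgue. G (A i) \<omega> * \<rho> \<omega>) sums
           (LINT \<omega>|lebesgue. G (\<Union>i. A i) \<omega> * \<rho> \<omega>)))"

(* For L^infinity functions g t (t \<le> n) and causal operators \<Phi> t from time t to time t - 1:
   g_t \<cdot> \<Phi>^{t,t+1} (g_{t+1} \<cdot> \<Phi>^{t+1,t+2} (\<dots> \<cdot> \<Phi>^{n-1,n} g_n)). *)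
function realize ::
  "nat \<Rightarrow> (nat \<Rightarrow> (real \<Rightarrow> real) \<Rightarrow> real \<Rightarrow> real) \<Rightarrow> (nat \<Rightarrow> real \<Rightarrow> real) \<Rightarrow> nat \<Rightarrow> real \<Rightarrow> real" where
  "realize n \<Phi> g t =
     (if t < n then (\<lambda>\<omega>. g t \<omega> * \<Phi> (Suc t) (realize n \<Phi> g (Suc t)) \<omega>) else g t)"
  by pat_completeness auto
termination by (relation "Wellfounded.measure (\<lambda>(n, \<Phi>, g, t). n - t)") auto
declare realize.simps [simp del]

(* The value of the realized observable at time 0 on the rectangle \<Xi> 0 \<times> \<dots> \<times> \<Xi> n. *)
definition F_hat0 ::
  "nat \<Rightarrow> (nat \<Rightarrow> real set \<Rightarrow> real \<Rightarrow> real) \<Rightarrow> (nat \<Rightarrow> (real \<Rightarrow> real) \<Rightarrow> real \<Rightarrow> real)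
    \<Rightarrow> (nat \<Rightarrow> real set) \<Rightarrow> real \<Rightarrow> real" where
  "F_hat0 n F \<Phi> \<Xi> = realize n \<Phi> (\<lambda>t. F t (\<Xi> t)) 0"

(* Here g stands for the element G(\<Gamma>) of L^infinity at time s. *)
definition H_hat0 ::
  "nat \<Rightarrow> (nat \<Rightarrow> real set \<Rightarrow> real \<Rightarrow> real) \<Rightarrow> (nat \<Rightarrow> (real \<Rightarrow> real) \<Rightarrow> real \<Rightarrow> real)
    \<Rightarrow> nat \<Rightarrow> (real \<Rightarrow> real) \<Rightarrow> (nat \<Rightarrow> real set) \<Rightarrow> real \<Rightarrow> real" where
  "H_hat0 n F \<Phi> s g \<Xi> =
     realize n \<Phi> ((\<lambda>t. F t (\<Xi> t))(s := (\<lambda>\<omega>. F s (\<Xi> s) \<omega> * g \<omega>))) 0"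

definition bayes_ratio ::
  "nat \<Rightarrow> (nat \<Rightarrow> real set \<Rightarrow> real \<Rightarrow> real) \<Rightarrow> (nat \<Rightarrow> (real \<Rightarrow> real) \<Rightarrow> real \<Rightarrow> real)
    \<Rightarrow> nat \<Rightarrow> (real \<Rightarrow> real) \<Rightarrow> (real \<Rightarrow> real) \<Rightarrow> (nat \<Rightarrow> real set) \<Rightarrow> real" where
  "bayes_ratio n F \<Phi> s \<rho>0 g \<Xi> =
     (LINT \<omega>|lebesgue. H_hat0 n F \<Phi> s g \<Xi> \<omega> * \<rho>0 \<omega>) /
     (LINT \<omega>|lebesgue. F_hat0 n F \<Phi> \<Xi> \<omega> * \<rho>0 \<omega>)"

(* HOL cannot quantify over all types inside a formula, so the type 'y of which the value spaces Y
   of the test observables are subsets is a parameter.  Below, the defining property is required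
   for an arbitrary type 'y, while uniqueness is required already among the states that have the
   property for value spaces in the type bool only. *)

definition bayes_kalman_eq ::
  "'y itself \<Rightarrow> nat \<Rightarrow> (nat \<Rightarrow> real set \<Rightarrow> real \<Rightarrow> real) \<Rightarrow> (nat \<Rightarrow> (real \<Rightarrow> real) \<Rightarrow> real \<Rightarrow> real)
    \<Rightarrow> nat \<Rightarrow> (real \<Rightarrow> real) \<Rightarrow> (nat \<Rightarrow> real set) \<Rightarrow> (real \<Rightarrow> real) \<Rightarrow> bool" where
  "bayes_kalman_eq _ n F \<Phi> s \<rho>0 \<Xi> \<rho> \<longleftrightarrow>
     mixed_state \<rho> \<and>
     (\<forall>(Y :: 'y set) \<G> G. observable Y \<G> G \<longrightarrow>
        (\<forall>\<Gamma>\<in>\<G>. bayes_ratio n F \<Phi> s \<rho>0 (G \<Gamma>) \<Xi> = (LINT \<omega>|lebesgue. G \<Gamma> \<omega> * \<rho> \<omega>)))"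

(* [B^s(\<Xi> 0 \<times> \<dots> \<times> \<Xi> n)](\<rho>0) is defined and equals \<rho> *)
definition has_bayes_kalman ::
  "'y itself \<Rightarrow> nat \<Rightarrow> (nat \<Rightarrow> real set \<Rightarrow> real \<Rightarrow> real) \<Rightarrow> (nat \<Rightarrow> (real \<Rightarrow> real) \<Rightarrow> real \<Rightarrow> real)
    \<Rightarrow> nat \<Rightarrow> (real \<Rightarrow> real) \<Rightarrow> (nat \<Rightarrow> real set) \<Rightarrow> (real \<Rightarrow> real) \<Rightarrow> bool" where
  "has_bayes_kalman T n F \<Phi> s \<rho>0 \<Xi> \<rho> \<longleftrightarrow>
     (\<forall>t\<le>n. \<Xi> t \<in> sets borel) \<and>
     0 < (LINT \<omega>|lebesgue. F_hat0 n F \<Phi> \<Xi> \<omega> * \<rho>0 \<omega>) \<and>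
     bayes_kalman_eq T n F \<Phi> s \<rho>0 \<Xi> \<rho> \<and>
     (\<forall>\<rho>'. bayes_kalman_eq TYPE(bool) n F \<Phi> s \<rho>0 \<Xi> \<rho>' \<longrightarrow> (AE \<omega> in lebesgue. \<rho>' \<omega> = \<rho> \<omega>))"

(* The filter \<Xi>_t \<rightarrow> x_t (t = 0, \<dots>, n) *)
definition shrinking_intervals :: "nat \<Rightarrow> (nat \<Rightarrow> real) \<Rightarrow> (nat \<Rightarrow> real set) filter" where
  "shrinking_intervals n x =
     (INF e\<in>{0<..}. principal {\<Xi>. \<forall>t\<le>n. is_interval (\<Xi> t) \<and> x t \<in> \<Xi> t \<and>
        0 < emeasure lebesgue (\<Xi> t) \<and> emeasure lebesgue (\<Xi> t) < ennreal e})"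

definition bayes_kalman_lim ::
  "'y itself \<Rightarrow> nat \<Rightarrow> (nat \<Rightarrow> real set \<Rightarrow> real \<Rightarrow> real) \<Rightarrow> (nat \<Rightarrow> (real \<Rightarrow> real) \<Rightarrow> real \<Rightarrow> real)
    \<Rightarrow> nat \<Rightarrow> (real \<Rightarrow> real) \<Rightarrow> (nat \<Rightarrow> real) \<Rightarrow> (real \<Rightarrow> real) \<Rightarrow> bool" where
  "bayes_kalman_lim _ n F \<Phi> s \<rho>0 x \<rho> \<longleftrightarrow>
     mixed_state \<rho> \<and>
     (\<forall>(Y :: 'y set) \<G> G. observable Y \<G> G \<longrightarrow>
        (\<forall>\<Gamma>\<in>\<G>. (bayes_ratio n F \<Phi> s \<rho>0 (G \<Gamma>) \<longlongrightarrow> (LINT \<omega>|lebesgue. G \<Gamma> \<omega> * \<rho> \<omega>))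
                  (shrinking_intervals n x)))"

(* [B^s({x 0} \<times> \<dots> \<times> {x n})](\<rho>0) is defined and equals \<rho> *)
definition has_bayes_kalman_at ::
  "'y itself \<Rightarrow> nat \<Rightarrow> (nat \<Rightarrow> real set \<Rightarrow> real \<Rightarrow> real) \<Rightarrow> (nat \<Rightarrow> (real \<Rightarrow> real) \<Rightarrow> real \<Rightarrow> real)
    \<Rightarrow> nat \<Rightarrow> (real \<Rightarrow> real) \<Rightarrow> (nat \<Rightarrow> real) \<Rightarrow> (real \<Rightarrow> real) \<Rightarrow> bool" where
  "has_bayes_kalman_at T n F \<Phi> s \<rho>0 x \<rho> \<longleftrightarrow>
     (\<forall>\<^sub>F \<Xi> in shrinking_intervals n x. \<exists>\<rho>\<^sub>\<Xi>. has_bayes_kalman T n F \<Phi> s \<rho>0 \<Xi> \<rho>\<^sub>\<Xi>) \<and>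
     bayes_kalman_lim T n F \<Phi> s \<rho>0 x \<rho> \<and>
     (\<forall>\<rho>'. bayes_kalman_lim TYPE(bool) n F \<Phi> s \<rho>0 x \<rho>' \<longrightarrow> (AE \<omega> in lebesgue. \<rho>' \<omega> = \<rho> \<omega>))"

definition gauss_obs ::
  "(nat \<Rightarrow> real) \<Rightarrow> (nat \<Rightarrow> real) \<Rightarrow> (nat \<Rightarrow> real) \<Rightarrow> nat \<Rightarrow> real set \<Rightarrow> real \<Rightarrow> real" where
  "gauss_obs c d q t \<Xi> \<omega> = (LINT y:\<Xi>|lebesgue. normal_density (c t * \<omega> + d t) (q t) y)"

(* gauss_causal a b r t is \<Phi>^{t-1,t}. *)
definition gauss_causal ::
  "(nat \<Rightarrow> real) \<Rightarrow> (nat \<Rightarrow> real) \<Rightarrow> (nat \<Rightarrow> real) \<Rightarrow> nat \<Rightarrow> (real \<Rightarrow> real) \<Rightarrow> real \<Rightarrow> real" where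
  "gauss_causal a b r t f \<omega> = (LINT y|lebesgue. normal_density (a t * \<omega> + b t) (r t) y * f y)"

(* Forward quantities.  The recursion runs on the pair of \<mu>_t and the variance \<sigma>_t^2. *)
primrec forward ::
  "real \<Rightarrow> real \<Rightarrow> (nat \<Rightarrow> real) \<Rightarrow> (nat \<Rightarrow> real) \<Rightarrow> (nat \<Rightarrow> real) \<Rightarrow> (nat \<Rightarrow> real) \<Rightarrow> (nat \<Rightarrow> real)
    \<Rightarrow> (nat \<Rightarrow> real) \<Rightarrow> (nat \<Rightarrow> real) \<Rightarrow> nat \<Rightarrow> real \<times> real" where
  "forward \<mu>0 \<sigma>0 c d q a b r x 0 = (\<mu>0, \<sigma>0\<^sup>2)"
| "forward \<mu>0 \<sigma>0 c d q a b r x (Suc t) =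
     (let (\<mu>, var) = forward \<mu>0 \<sigma>0 c d q a b r x t;
          var' = (q t)\<^sup>2 * var / ((q t)\<^sup>2 + (c t)\<^sup>2 * var);
          \<mu>' = \<mu> + var' * (c t / (q t)\<^sup>2) * (x t - d t - c t * \<mu>)
      in (a (Suc t) * \<mu>' + b (Suc t), (a (Suc t))\<^sup>2 * var' + (r (Suc t))\<^sup>2))"

definition forward_density ::
  "real \<Rightarrow> real \<Rightarrow> (nat \<Rightarrow> real) \<Rightarrow> (nat \<Rightarrow> real) \<Rightarrow> (nat \<Rightarrow> real) \<Rightarrow> (nat \<Rightarrow> real) \<Rightarrow> (nat \<Rightarrow> real)
    \<Rightarrow> (nat \<Rightarrow> real) \<Rightarrow> (nat \<Rightarrow> real) \<Rightarrow> nat \<Rightarrow> real \<Rightarrow> real" where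
  "forward_density \<mu>0 \<sigma>0 c d q a b r x s =
     (let (\<mu>, var) = forward \<mu>0 \<sigma>0 c d q a b r x s in normal_density \<mu> (sqrt var))"

(* Backward quantities: the pair of u~_t and v~_t, computed from the pair (U, V) at time t + 1.
   If c t = u = 0 then the second component is 0, since division by 0 yields 0. *)
function backward ::
  "nat \<Rightarrow> (nat \<Rightarrow> real) \<Rightarrow> (nat \<Rightarrow> real) \<Rightarrow> (nat \<Rightarrow> real) \<Rightarrow> (nat \<Rightarrow> real) \<Rightarrow> (nat \<Rightarrow> real)
    \<Rightarrow> (nat \<Rightarrow> real) \<Rightarrow> (nat \<Rightarrow> real) \<Rightarrow> nat \<Rightarrow> real \<times> real" where
  "backward n c d q a b r x t =
     (if t < n then
        (let (U, V) = backward n c d q a b r x (Suc t);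
             u = - (a (Suc t) * U / sqrt (1 + (r (Suc t))\<^sup>2 * U\<^sup>2));
             v = (b (Suc t) * U - V) / sqrt (1 + (r (Suc t))\<^sup>2 * U\<^sup>2)
         in (sqrt ((c t)\<^sup>2 + u\<^sup>2 * (q t)\<^sup>2) / q t,
             (c t * (x t - d t) + u * v * (q t)\<^sup>2) / (q t * sqrt ((c t)\<^sup>2 + u\<^sup>2 * (q t)\<^sup>2))))
      else (c t / q t, (x t - d t) / q t))"
  by pat_completeness auto
termination by (relation "Wellfounded.measure (\<lambda>(n, c, d, q, a, b, r, x, t). n - t)") auto
declare backward.simps [simp del]

definition backward_likelihood ::
  "nat \<Rightarrow> (nat \<Rightarrow> real) \<Rightarrow> (nat \<Rightarrow> real) \<Rightarrow> (nat \<Rightarrow> real) \<Rightarrow> (nat \<Rightarrow> real) \<Rightarrow> (nat \<Rightarrow> real)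
    \<Rightarrow> (nat \<Rightarrow> real) \<Rightarrow> (nat \<Rightarrow> real) \<Rightarrow> nat \<Rightarrow> real \<Rightarrow> real" where
  "backward_likelihood n c d q a b r x s \<omega> =
     (let (U, V) = backward n c d q a b r x s in exp (- (1/2) * (U * \<omega> - V)\<^sup>2))"

end

(* Transposing the causal operators one at a time (Fubini) moves everything before time s onto the
   initial state: the numerator of the Bayes ratio becomes the integral of G(Gamma) against the
   product of a forward unnormalised state and a backward realization, both taken at time s.
   Dividing F_t(Xi_t) by the length of Xi_t makes it converge, uniformly in omega, to the Gaussian
   density at x_t, because Gaussian densities are Lipschitz; the scaling cancels in the ratio.  For
   the limiting weights, completing the square shows that the forward state is a multiple of rho_s
   and the backward realization a multiple of the likelihood.  Uniqueness needs only the two-valued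
   observables given by a Lebesgue set and its complement. *)

theory Submission
  imports Defs
begin

section \<open>Gaussian averages of essentially bounded functions\<close>

text \<open>The limit has to pass through nested integrals, along a filter of families of intervals.
  Uniform convergence survives this: averaging against a probability density contracts the sup norm,
  and products of uniform limits converge when the limits are bounded. That argument asks for bounds
  valid at every point, whereas elements of L^infinity are bounded only almost everywhere. Two facts
  bridge the gap: a Gaussian average of an almost everywhere bounded function is bounded everywhere,
  and under an integral against an L^1 function an effect may be exchanged for a truncated
  representative. Division by masses is justified at time 0, where the initial Gaussian and every
  realization are strictly positive at each point.\<close>

interpretation lebesgue: sigma_finite_measure "lebesgue :: 'a::euclidean_space measure"
proof
  \<comment> \<open>Completion keeps the measure of Borel sets, so a countable cover of finite
    measure carries over from \<open>lborel\<close>.\<close>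
  obtain A :: "'a set set" where A: "countable A" "A \<subseteq> sets lborel" "\<Union>A = space lborel"
    "\<forall>a\<in>A. emeasure lborel a \<noteq> \<infinity>"
    using lborel.sigma_finite_countable by blast
  then show "\<exists>A. countable A \<and> A \<subseteq> sets lebesgue \<and> \<Union>A = space lebesgue \<and>
      (\<forall>a\<in>A. emeasure lebesgue (a :: 'a set) \<noteq> \<infinity>)"
    by (intro exI[of _ A]) auto
qed

interpretation lebesgue_pair: pair_sigma_finite "lebesgue :: real measure" "lebesgue :: real measure" ..

lemma measurable_lebesgue_ident [measurable]: "(\<lambda>x::real. x) \<in> lebesgue \<rightarrow>\<^sub>M borel"
  using id_borel_measurable_lebesgue by (simp add: id_def)

lemma measurable_gauss_kernel [measurable]:
  assumes [measurable]: "f \<in> borel_measurable M" "g \<in> borel_measurable M"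
  shows "(\<lambda>z. normal_density (f z) \<sigma> (g z)) \<in> borel_measurable M"
  unfolding normal_density_def by measurable

lemma has_integral_gauss_kernel:
  assumes "\<sigma> > 0"
  shows "integrable lebesgue (normal_density \<mu> \<sigma>)" "(LINT y|lebesgue. normal_density \<mu> \<sigma> y) = 1"
  using assms by (simp_all add: integrable_completion integral_completion)

text \<open>A zero integral would make \<open>f\<close> vanish almost everywhere and so turn the
  whole line into a null set. Positivity of Gaussian averages and of posterior masses rests on
  this.\<close>

lemma lebesgue_integral_pos:
  fixes f :: "real \<Rightarrow> real"
  assumes "integrable lebesgue f" "\<And>x. 0 < f x"
  shows "0 < (LINT x|lebesgue. f x)"
proof -
  have "(LINT x|lebesgue. f x) \<noteq> 0"
  proof
    assume "(LINT x|lebesgue. f x) = 0"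
    then have "AE x in lebesgue. f x = 0"
      using assms by (subst (asm) integral_nonneg_eq_0_iff_AE) (auto simp: less_imp_le)
    then have "AE x in (lebesgue :: real measure). False"
      using assms(2) by (auto simp: less_le)
    then have "emeasure lebesgue (UNIV :: real set) = 0"
      by (simp add: trivial_limit_def[symmetric] ae_filter_eq_bot_iff)
    then show False by simp
  qed
  moreover have "0 \<le> (LINT x|lebesgue. f x)"
    using assms(2) by (intro integral_nonneg_AE) (auto simp: less_imp_le)
  ultimately show ?thesis by simp
qed

text \<open>Representatives of L^infinity. The bound may fail on a null set, because this is all
  that an effect \<open>G \<Gamma>\<close> guarantees.\<close>

definition ess_bounded :: "(real \<Rightarrow> real) \<Rightarrow> bool" where
  "ess_bounded f \<longleftrightarrow> f \<in> borel_measurable lebesgue \<and> (\<exists>C. AE \<omega> in lebesgue. \<bar>f \<omega>\<bar> \<le> C)"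

lemma ess_boundedI:
  "f \<in> borel_measurable lebesgue \<Longrightarrow> (\<And>\<omega>. \<bar>f \<omega>\<bar> \<le> C) \<Longrightarrow> ess_bounded f"
  by (auto simp: ess_bounded_def)

lemma ess_bounded_mult: "ess_bounded f \<Longrightarrow> ess_bounded g \<Longrightarrow> ess_bounded (\<lambda>\<omega>. f \<omega> * g \<omega>)"
proof -
  assume fg: "ess_bounded f" "ess_bounded g"
  then obtain C D where "AE \<omega> in lebesgue. \<bar>f \<omega>\<bar> \<le> C" "AE \<omega> in lebesgue. \<bar>g \<omega>\<bar> \<le> D"
    by (auto simp: ess_bounded_def)
  then have "AE \<omega> in lebesgue. \<bar>f \<omega> * g \<omega>\<bar> \<le> C * D"
    by eventually_elim (auto simp: abs_mult intro!: mult_mono)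
  with fg show ?thesis by (auto simp: ess_bounded_def)
qed

lemma integrable_mult_ess_bounded:
  assumes "integrable lebesgue f" "ess_bounded g"
  shows "integrable lebesgue (\<lambda>\<omega>. f \<omega> * g \<omega>)"
proof -
  obtain C where C: "AE \<omega> in lebesgue. \<bar>g \<omega>\<bar> \<le> C" and [measurable]: "g \<in> borel_measurable lebesgue"
    using assms(2) by (auto simp: ess_bounded_def)
  have [measurable]: "f \<in> borel_measurable lebesgue"
    using assms(1) by auto
  show ?thesis
  proof (rule Bochner_Integration.integrable_bound)
    show "integrable lebesgue (\<lambda>\<omega>. C * f \<omega>)" using assms(1) by simp
    show "AE \<omega> in lebesgue. norm (f \<omega> * g \<omega>) \<le> norm (C * f \<omega>)"
      using C by eventually_elim (auto simp: abs_mult mult.commute[of C] intro!: mult_left_mono)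
  qed measurable
qed

text \<open>The weight is a probability density and the integral does not see the exceptional null
  set; an almost everywhere bound on \<open>f\<close> thus becomes a bound for every
  \<open>\<mu>\<close>.\<close>

lemma gauss_average_bound:
  assumes "\<sigma> > 0" and [measurable]: "f \<in> borel_measurable lebesgue"
    and "AE y in lebesgue. \<bar>f y\<bar> \<le> C"
  shows "\<bar>LINT y|lebesgue. normal_density \<mu> \<sigma> y * f y\<bar> \<le> C"
proof -
  have f: "ess_bounded f" using assms by (auto simp: ess_bounded_def)
  have "\<bar>LINT y|lebesgue. normal_density \<mu> \<sigma> y * f y\<bar> \<le> (LINT y|lebesgue. \<bar>normal_density \<mu> \<sigma> y * f y\<bar>)"
    using integral_norm_bound[of lebesgue "\<lambda>y. normal_density \<mu> \<sigma> y * f y"] by simp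
  also have "\<dots> \<le> (LINT y|lebesgue. normal_density \<mu> \<sigma> y * C)"
  proof (rule integral_mono_AE)
    show "AE y in lebesgue. \<bar>normal_density \<mu> \<sigma> y * f y\<bar> \<le> normal_density \<mu> \<sigma> y * C"
      using assms(3) by eventually_elim (auto simp: abs_mult intro!: mult_left_mono)
  qed (use assms f integrable_mult_ess_bounded has_integral_gauss_kernel in auto)
  also have "\<dots> = C" using has_integral_gauss_kernel(2)[OF assms(1)] by simp
  finally show ?thesis .
qed

text \<open>\<open>Tf\<close> is the transpose of the averaging operator, acting on L^1, and the
  identity is Fubini. The kernel has mass 1 in \<open>y\<close> for each \<open>\<omega>\<close>, so
  integrating over \<open>y\<close> first leaves at most a constant times |f|; this yields joint
  integrability.\<close>

lemma gauss_average_duality: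
  fixes \<alpha> \<beta> \<sigma> :: real and f g :: "real \<Rightarrow> real"
  assumes "\<sigma> > 0" and f: "integrable lebesgue f" and g: "ess_bounded g"
  defines "Tf \<equiv> \<lambda>y. LINT \<omega>|lebesgue. f \<omega> * normal_density (\<alpha> * \<omega> + \<beta>) \<sigma> y"
  shows "integrable lebesgue Tf"
    and "(LINT \<omega>|lebesgue. f \<omega> * (LINT y|lebesgue. normal_density (\<alpha> * \<omega> + \<beta>) \<sigma> y * g y)) =
      (LINT y|lebesgue. Tf y * g y)"
proof -
  have int: "integrable (lebesgue \<Otimes>\<^sub>M lebesgue)
      (\<lambda>(\<omega>, y). f \<omega> * normal_density (\<alpha> * \<omega> + \<beta>) \<sigma> y * h y)" if h: "ess_bounded h" for h
  proof -
    obtain C where C: "AE \<omega> in lebesgue. \<bar>h \<omega>\<bar> \<le> C" and [measurable]: "h \<in> borel_measurable lebesgue"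
      using h by (auto simp: ess_bounded_def)
    have [measurable]: "f \<in> borel_measurable lebesgue"
      using f by auto
    \<comment> \<open>The absolute value of \<open>f\<close> is split as \<open>f * sgn f\<close>,
      which exhibits the inner integral as the integrable \<open>f\<close> times an essentially
      bounded factor.\<close>
    have eq: "(LINT y|lebesgue. norm (f \<omega> * normal_density (\<alpha> * \<omega> + \<beta>) \<sigma> y * h y)) =
        f \<omega> * (sgn (f \<omega>) * (LINT y|lebesgue. normal_density (\<alpha> * \<omega> + \<beta>) \<sigma> y * \<bar>h y\<bar>))" for \<omega>
    proof -
      have "(LINT y|lebesgue. norm (f \<omega> * normal_density (\<alpha> * \<omega> + \<beta>) \<sigma> y * h y)) =
         (LINT y|lebesgue. \<bar>f \<omega>\<bar> * (normal_density (\<alpha> * \<omega> + \<beta>) \<sigma> y * \<bar>h y\<bar>))"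
        by (simp add: abs_mult mult.assoc)
      then show ?thesis by (simp add: abs_sgn mult.assoc)
    qed
    show ?thesis
    proof (rule lebesgue_pair.Fubini_integrable)
      have "\<bar>LINT y|lebesgue. normal_density (\<alpha> * \<omega> + \<beta>) \<sigma> y * \<bar>h y\<bar>\<bar> \<le> C" for \<omega>
        using C by (intro gauss_average_bound assms) auto
      moreover have "\<bar>sgn u * v\<bar> \<le> \<bar>v\<bar>" for u v :: real
        by (simp add: abs_mult abs_sgn_eq)
      ultimately have "\<bar>sgn (f \<omega>) * (LINT y|lebesgue. normal_density (\<alpha> * \<omega> + \<beta>) \<sigma> y * \<bar>h y\<bar>)\<bar> \<le> C" for \<omega>
        by (rule order_trans[rotated])
      then have "ess_bounded (\<lambda>\<omega>. sgn (f \<omega>) * (LINT y|lebesgue. normal_density (\<alpha> * \<omega> + \<beta>) \<sigma> y * \<bar>h y\<bar>))"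
        unfolding ess_bounded_def by (intro conjI exI[of _ C]) auto
      from integrable_mult_ess_bounded[OF f this]
      show "integrable lebesgue (\<lambda>\<omega>. LINT y|lebesgue.
          norm (case (\<omega>, y) of (\<omega>, y) \<Rightarrow> f \<omega> * normal_density (\<alpha> * \<omega> + \<beta>) \<sigma> y * h y))"
        by (simp only: prod.case eq)
      show "AE \<omega> in lebesgue. integrable lebesgue
          (\<lambda>y. case (\<omega>, y) of (\<omega>, y) \<Rightarrow> f \<omega> * normal_density (\<alpha> * \<omega> + \<beta>) \<sigma> y * h y)"
        using integrable_mult_ess_bounded[OF has_integral_gauss_kernel(1)[OF assms(1)] h]
        by (auto simp: mult.assoc)
    qed measurable
  qed
  \<comment> \<open>Testing with the constant 1 gives joint integrability of the kernel weighted by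
    \<open>f\<close> alone.\<close>
  have "integrable (lebesgue \<Otimes>\<^sub>M lebesgue) (\<lambda>(\<omega>, y). f \<omega> * normal_density (\<alpha> * \<omega> + \<beta>) \<sigma> y)"
    using int[of "\<lambda>_. 1"] by (auto simp: ess_bounded_def)
  from lebesgue_pair.integrable_snd[OF this] show "integrable lebesgue Tf"
    by (simp add: Tf_def)
  have "(LINT y|lebesgue. Tf y * g y) =
      (LINT y|lebesgue. LINT \<omega>|lebesgue. f \<omega> * normal_density (\<alpha> * \<omega> + \<beta>) \<sigma> y * g y)"
    by (simp add: Tf_def)
  also have "\<dots> = (LINT \<omega>|lebesgue. LINT y|lebesgue. f \<omega> * normal_density (\<alpha> * \<omega> + \<beta>) \<sigma> y * g y)"
    using int[OF g] by (rule lebesgue_pair.Fubini_integral)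
  finally show "(LINT \<omega>|lebesgue. f \<omega> * (LINT y|lebesgue. normal_density (\<alpha> * \<omega> + \<beta>) \<sigma> y * g y)) =
      (LINT y|lebesgue. Tf y * g y)"
    by (simp add: mult.assoc)
qed

section \<open>Gaussian densities\<close>

text \<open>Bayes' rule for a Gaussian prior with mean \<open>\<mu>\<close> and variance
  \<open>v\<close> and an observation \<open>x\<close> of \<open>c * \<omega> + d\<close> with noise
  \<open>q\<close>: marginal density of \<open>x\<close> times posterior density.
  \<open>\<mu>'\<close> and \<open>v'\<close> are the update formulas of the forward
  recursion.\<close>

lemma normal_density_mult_linear:
  fixes \<mu> v q c d x \<omega> :: real
  assumes "v > 0" "q > 0"
  defines "v' \<equiv> q\<^sup>2 * v / (q\<^sup>2 + c\<^sup>2 * v)"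
  defines "\<mu>' \<equiv> \<mu> + v' * (c / q\<^sup>2) * (x - d - c * \<mu>)"
  shows "normal_density \<mu> (sqrt v) \<omega> * normal_density (c * \<omega> + d) q x =
    normal_density (c * \<mu> + d) (sqrt (c\<^sup>2 * v + q\<^sup>2)) x * normal_density \<mu>' (sqrt v') \<omega>"
proof -
  define w where "w = c\<^sup>2 * v + q\<^sup>2"
  have w: "w > 0" using assms by (auto simp: w_def intro: add_nonneg_pos)
  have v': "v' = q\<^sup>2 * v / w" by (simp add: v'_def w_def algebra_simps)
  have v'_pos: "v' > 0" using w assms(1,2) by (simp add: v')
  have "(\<omega> - \<mu>)\<^sup>2 / (2 * v) + (x - (c * \<omega> + d))\<^sup>2 / (2 * q\<^sup>2) =
      (x - (c * \<mu> + d))\<^sup>2 / (2 * w) + (\<omega> - \<mu>')\<^sup>2 / (2 * v')"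
  proof -
    define z where "z = \<omega> - \<mu>"
    define y where "y = x - d - c * \<mu>"
    have 1: "\<omega> - \<mu>' = (w * z - v * c * y) / w"
      using w assms(1,2) by (simp add: \<mu>'_def v' z_def y_def field_simps)
    have 2: "x - (c * \<omega> + d) = y - c * z" "x - (c * \<mu> + d) = y"
      by (simp_all add: y_def z_def algebra_simps)
    have "z\<^sup>2 / (2 * v) + (y - c * z)\<^sup>2 / (2 * q\<^sup>2) =
      y\<^sup>2 / (2 * w) + ((w * z - v * c * y) / w)\<^sup>2 / (2 * v')"
    proof -
      have "(z\<^sup>2 / (2 * v) + (y - c * z)\<^sup>2 / (2 * q\<^sup>2)) * (2 * v * q\<^sup>2 * w) =
          (z\<^sup>2 * q\<^sup>2 + (y - c * z)\<^sup>2 * v) * w"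
        using assms(1,2) by (simp add: field_simps)
      also have "\<dots> = y\<^sup>2 * v * q\<^sup>2 + (w * z - v * c * y)\<^sup>2"
        unfolding w_def by algebra
      also have "\<dots> = (y\<^sup>2 / (2 * w) + ((w * z - v * c * y) / w)\<^sup>2 / (2 * v')) * (2 * v * q\<^sup>2 * w)"
        using assms(1,2) w by (simp add: v' field_simps power2_eq_square)
      finally show ?thesis
        using assms(1,2) w by simp
    qed
    then show ?thesis unfolding 1 2 z_def[symmetric] .
  qed
  then have "exp (- (\<omega> - \<mu>)\<^sup>2 / (2 * v)) * exp (- (x - (c * \<omega> + d))\<^sup>2 / (2 * q\<^sup>2)) =
      exp (- (x - (c * \<mu> + d))\<^sup>2 / (2 * w)) * exp (- (\<omega> - \<mu>')\<^sup>2 / (2 * v'))"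
    unfolding exp_add[symmetric] by simp
  \<comment> \<open>The normalising constants agree because \<open>v * q^2 = w * v'\<close>.\<close>
  moreover have "sqrt (2 * pi * v) * sqrt (2 * pi * q\<^sup>2) = sqrt (2 * pi * w) * sqrt (2 * pi * v')"
    unfolding real_sqrt_mult[symmetric] using w by (simp add: v')
  ultimately show ?thesis
    unfolding w_def[symmetric] normal_density_def using assms(1) v'_pos w
    by (simp add: mult.commute mult.left_commute)
qed

text \<open>The posterior density integrates to 1, leaving the marginal of \<open>x\<close>. With a
  transition kernel in place of the observation, this is the prediction step of the forward
  recursion.\<close>

lemma integral_normal_density_mult_linear:
  fixes \<mu> v q c d x :: real
  assumes "v > 0" "q > 0"
  shows "(LINT \<omega>|lebesgue. normal_density \<mu> (sqrt v) \<omega> * normal_density (c * \<omega> + d) q x) =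
    normal_density (c * \<mu> + d) (sqrt (c\<^sup>2 * v + q\<^sup>2)) x"
proof -
  have "0 < q\<^sup>2 * v / (q\<^sup>2 + c\<^sup>2 * v)"
    using assms by (intro divide_pos_pos add_pos_nonneg) auto
  then show ?thesis
    by (simp add: normal_density_mult_linear[OF assms] has_integral_gauss_kernel(2))
qed

text \<open>The constant depends on \<open>\<sigma>\<close> but not on \<open>\<mu>\<close>, which
  later makes convergence uniform in the state. With \<open>u = (z - \<mu>) / \<sigma>\<close> the
  derivative has modulus \<open>|u| * exp (- u^2 / 2) / sqrt (2 * pi) / \<sigma>^2\<close>, and |u|
  <= (u^2 + 1) / 2 <= exp (u^2 / 2).\<close>

lemma normal_density_lipschitz:
  assumes "\<sigma> > 0"
  shows "\<bar>normal_density \<mu> \<sigma> y - normal_density \<mu> \<sigma> x\<bar> \<le> \<bar>y - x\<bar> / \<sigma>\<^sup>2"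
proof -
  have "norm (normal_density \<mu> \<sigma> y - normal_density \<mu> \<sigma> x) \<le> 1 / \<sigma>\<^sup>2 * norm (y - x)"
  proof (rule field_differentiable_bound[OF convex_UNIV])
    fix z :: real
    define u where "u = (z - \<mu>) / \<sigma>"
    have z: "z - \<mu> = \<sigma> * u" using assms by (simp add: u_def)
    show "(normal_density \<mu> \<sigma> has_field_derivative
        (- (z - \<mu>) / \<sigma>\<^sup>2 * normal_density \<mu> \<sigma> z)) (at z)"
      unfolding normal_density_def
      by (rule derivative_eq_intros refl | use assms in \<open>simp add: power2_eq_square field_simps\<close>)+
    have "u\<^sup>2 / 2 + 1 \<le> exp (u\<^sup>2 / 2)"
      using exp_ge_add_one_self[of "u\<^sup>2 / 2"] by linarith
    moreover have "2 * \<bar>u\<bar> \<le> u\<^sup>2 + 1"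
      using sum_squares_bound[of "\<bar>u\<bar>" 1] by (simp add: power2_eq_square)
    ultimately have "\<bar>u\<bar> \<le> exp (u\<^sup>2 / 2)" by linarith
    then have "\<bar>u\<bar> * exp (- (u\<^sup>2 / 2)) \<le> 1"
      by (simp add: exp_minus field_simps)
    moreover have "1 \<le> sqrt (2 * pi)"
      using pi_gt3 by simp
    ultimately have "\<bar>u\<bar> * exp (- (u\<^sup>2 / 2)) / sqrt (2 * pi) \<le> 1"
      by (metis divide_le_eq_1 order_trans less_le_trans zero_less_one)
    moreover have "\<bar>- (z - \<mu>) / \<sigma>\<^sup>2 * normal_density \<mu> \<sigma> z\<bar> =
        (\<bar>u\<bar> * exp (- (u\<^sup>2 / 2)) / sqrt (2 * pi)) / \<sigma>\<^sup>2"
      unfolding normal_density_def z using assms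
      by (simp add: abs_mult real_sqrt_mult power_mult_distrib field_simps power2_eq_square)
    ultimately show "norm (- (z - \<mu>) / \<sigma>\<^sup>2 * normal_density \<mu> \<sigma> z) \<le> 1 / \<sigma>\<^sup>2"
      by (simp only: real_norm_def divide_right_mono zero_le_power2)
  qed auto
  then show ?thesis by simp
qed

lemma normal_density_le:
  "normal_density \<mu> \<sigma> y \<le> normal_density 0 \<sigma> 0"
  unfolding normal_density_def by (auto intro!: divide_right_mono)

section \<open>Duality between realization and propagation\<close>

lemma gauss_causal_bound:
  assumes "r t > 0" "f \<in> borel_measurable lebesgue" "AE y in lebesgue. \<bar>f y\<bar> \<le> C"
  shows "\<bar>gauss_causal a b r t f \<omega>\<bar> \<le> C"
  unfolding gauss_causal_def using assms by (rule gauss_average_bound)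

lemma measurable_gauss_causal:
  assumes [measurable]: "f \<in> borel_measurable lebesgue"
  shows "gauss_causal a b r t f \<in> borel_measurable lebesgue"
  unfolding gauss_causal_def by measurable

lemma gauss_causal_pos:
  assumes "r t > 0" "ess_bounded f" "\<And>\<omega>. 0 < f \<omega>"
  shows "0 < gauss_causal a b r t f \<omega>"
  unfolding gauss_causal_def using assms
  by (intro lebesgue_integral_pos integrable_mult_ess_bounded has_integral_gauss_kernel mult_pos_pos normal_density_pos) auto

lemma realize_last: "realize n \<Phi> g n = g n"
  by (subst realize.simps) simp

lemma realize_step: "t < n \<Longrightarrow> realize n \<Phi> g t = (\<lambda>\<omega>. g t \<omega> * \<Phi> (Suc t) (realize n \<Phi> g (Suc t)) \<omega>)"
  by (subst realize.simps) simp

lemma realize_cong: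
  assumes "\<And>i. t \<le> i \<Longrightarrow> i \<le> n \<Longrightarrow> g i = h i" "t \<le> n"
  shows "realize n \<Phi> g t = realize n \<Phi> h t"
  using \<open>t \<le> n\<close> assms(1)
  by (induction t rule: inc_induct) (auto simp: realize_last realize_step)

text \<open>At time \<open>s\<close> the weight \<open>g s\<close> occurs only as an outer factor,
  and the update leaves all later weights alone.\<close>

lemma realize_fun_upd_mult:
  assumes "s \<le> n"
  shows "realize n \<Phi> (g(s := \<lambda>\<omega>. g s \<omega> * h \<omega>)) s = (\<lambda>\<omega>. realize n \<Phi> g s \<omega> * h \<omega>)"
proof (cases "s < n")
  case True
  have "realize n \<Phi> (g(s := \<lambda>\<omega>. g s \<omega> * h \<omega>)) (Suc s) = realize n \<Phi> g (Suc s)"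
    using True by (intro realize_cong) auto
  with True show ?thesis by (auto simp: realize_step)
next
  case False
  with assms show ?thesis by (simp add: realize_last)
qed

text \<open>Causal operators are linear, so constants come out one time at a time. This is true for
  arbitrary \<open>g\<close>: an integrand that is not integrable has integral 0 before and after
  scaling. It is applied with the inverse lengths of the intervals as \<open>k\<close>.\<close>

lemma realize_scale:
  assumes "t \<le> n"
  shows "realize n (gauss_causal a b r) (\<lambda>i \<omega>. k i * g i \<omega>) t =
    (\<lambda>\<omega>. (\<Prod>i=t..n. k i) * realize n (gauss_causal a b r) g t \<omega>)"
  using assms
proof (induction t rule: inc_induct)
  case base
  then show ?case by (simp add: realize_last)
next
  case (step t)
  have "(\<Prod>i=t..n. k i) = k t * (\<Prod>i=Suc t..n. k i)"
    using step.hyps by (simp add: prod.atLeast_Suc_atMost)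
  with step show ?case
    by (simp add: realize_step gauss_causal_def mult.left_commute mult.assoc)
qed

lemma ess_bounded_gauss_causal:
  assumes "r t > 0" "ess_bounded f"
  shows "ess_bounded (gauss_causal a b r t f)"
proof -
  obtain C where C: "AE \<omega> in lebesgue. \<bar>f \<omega>\<bar> \<le> C" and [measurable]: "f \<in> borel_measurable lebesgue"
    using assms(2) by (auto simp: ess_bounded_def)
  have "\<bar>gauss_causal a b r t f \<omega>\<bar> \<le> C" for \<omega>
    using C assms(1) by (intro gauss_causal_bound) auto
  then show ?thesis
    by (intro ess_boundedI measurable_gauss_causal) auto
qed

lemma ess_bounded_realize:
  assumes "t \<le> n" "\<And>i. 1 \<le> i \<Longrightarrow> i \<le> n \<Longrightarrow> r i > 0" "\<And>i. i \<le> n \<Longrightarrow> ess_bounded (g i)"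
  shows "ess_bounded (realize n (gauss_causal a b r) g t)"
  using assms(1)
proof (induction t rule: inc_induct)
  case base
  then show ?case using assms(3) by (simp add: realize_last)
next
  case (step t)
  then show ?case
    using assms by (auto simp: realize_step intro!: ess_bounded_mult ess_bounded_gauss_causal)
qed

lemma realize_pos:
  assumes "t \<le> n" "\<And>i. 1 \<le> i \<Longrightarrow> i \<le> n \<Longrightarrow> r i > 0"
    and "\<And>i. i \<le> n \<Longrightarrow> ess_bounded (g i)" "\<And>i \<omega>. i \<le> n \<Longrightarrow> 0 < g i \<omega>"
  shows "0 < realize n (gauss_causal a b r) g t \<omega>"
  using assms(1)
proof (induction t arbitrary: \<omega> rule: inc_induct)
  case base
  then show ?case using assms(4) by (simp add: realize_last)
next
  case (step t)
  then show ?case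
    using assms by (auto simp: realize_step intro!: mult_pos_pos gauss_causal_pos ess_bounded_realize)
qed

text \<open>The predual counterpart of \<^const>\<open>realize\<close>: the unnormalised state at time \<open>t\<close> after the
  effects at the times before \<open>t\<close>.\<close>

primrec propagate ::
  "(nat \<Rightarrow> real) \<Rightarrow> (nat \<Rightarrow> real) \<Rightarrow> (nat \<Rightarrow> real) \<Rightarrow> (nat \<Rightarrow> real \<Rightarrow> real) \<Rightarrow> (real \<Rightarrow> real)
    \<Rightarrow> nat \<Rightarrow> real \<Rightarrow> real" where
  "propagate a b r g \<rho> 0 = \<rho>"
| "propagate a b r g \<rho> (Suc t) =
     (\<lambda>y. LINT \<omega>|lebesgue. propagate a b r g \<rho> t \<omega> * g t \<omega> *
        normal_density (a (Suc t) * \<omega> + b (Suc t)) (r (Suc t)) y)"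

lemma propagate_cong:
  "(\<And>i. i < t \<Longrightarrow> g i = h i) \<Longrightarrow> propagate a b r g \<rho> t = propagate a b r h \<rho> t"
  by (induction t) auto

lemma propagate_nonneg:
  "(\<And>\<omega>. 0 \<le> \<rho> \<omega>) \<Longrightarrow> (\<And>i \<omega>. i < t \<Longrightarrow> 0 \<le> g i \<omega>) \<Longrightarrow> 0 \<le> propagate a b r g \<rho> t \<omega>"
  by (induction t arbitrary: \<omega>) (auto intro!: integral_nonneg_AE)

lemma integrable_propagate:
  assumes "integrable lebesgue \<rho>" "t \<le> n"
    and "\<And>i. 1 \<le> i \<Longrightarrow> i \<le> n \<Longrightarrow> r i > 0" "\<And>i. i \<le> n \<Longrightarrow> ess_bounded (g i)"
  shows "integrable lebesgue (propagate a b r g \<rho> t)"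
  using assms(2)
proof (induction t)
  case (Suc t)
  \<comment> \<open>Serves as the test function \<open>g\<close> of
    \<open>gauss_average_duality\<close>.\<close>
  have "ess_bounded (\<lambda>_. 0)" by (auto simp: ess_bounded_def)
  with Suc assms show ?case
    by (auto intro!: gauss_average_duality(1) integrable_mult_ess_bounded)
qed (use assms in simp)

text \<open>Passing from \<open>s\<close> to \<open>Suc s\<close> transposes one causal operator:
  the weight \<open>g s\<close>, an outer factor of the realization at \<open>s\<close>, moves over
  to the state. Hence the state at time \<open>s\<close> carries exactly the weights of earlier
  times.\<close>

lemma realize_duality:
  assumes \<rho>: "integrable lebesgue \<rho>" and "s \<le> n"
    and r: "\<And>i. 1 \<le> i \<Longrightarrow> i \<le> n \<Longrightarrow> r i > 0" and g: "\<And>i. i \<le> n \<Longrightarrow> ess_bounded (g i)"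
  shows "(LINT \<omega>|lebesgue. realize n (gauss_causal a b r) g 0 \<omega> * \<rho> \<omega>) =
    (LINT \<omega>|lebesgue. propagate a b r g \<rho> s \<omega> * realize n (gauss_causal a b r) g s \<omega>)"
  using assms(2)
proof (induction s)
  case 0
  then show ?case by (simp add: mult.commute)
next
  case (Suc s)
  let ?R = "realize n (gauss_causal a b r) g"
  have "integrable lebesgue (\<lambda>\<omega>. propagate a b r g \<rho> s \<omega> * g s \<omega>)"
    using Suc.prems assms by (intro integrable_mult_ess_bounded integrable_propagate) auto
  moreover have "ess_bounded (?R (Suc s))"
    using Suc.prems r g by (intro ess_bounded_realize) auto
  ultimately have "(LINT \<omega>|lebesgue. (propagate a b r g \<rho> s \<omega> * g s \<omega>) * gauss_causal a b r (Suc s) (?R (Suc s)) \<omega>)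
      = (LINT y|lebesgue. propagate a b r g \<rho> (Suc s) y * ?R (Suc s) y)"
    unfolding gauss_causal_def propagate.simps using r Suc.prems
    by (intro gauss_average_duality) auto
  with Suc show ?case by (simp add: realize_step mult.assoc)
qed

text \<open>The propagated state at \<open>s\<close> involves earlier weights only and does not
  notice the inserted effect, which then leaves the realization as a factor. All effects are thereby
  integrated against one fixed function.\<close>

lemma realize_duality_effect:
  assumes \<rho>: "integrable lebesgue \<rho>" and s: "s \<le> n"
    and r: "\<And>i. 1 \<le> i \<Longrightarrow> i \<le> n \<Longrightarrow> r i > 0" and g: "\<And>i. i \<le> n \<Longrightarrow> ess_bounded (g i)"
    and h: "ess_bounded h"
  shows "(LINT \<omega>|lebesgue. realize n (gauss_causal a b r) (g(s := \<lambda>\<omega>. g s \<omega> * h \<omega>)) 0 \<omega> * \<rho> \<omega>) =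
    (LINT \<omega>|lebesgue. h \<omega> * (propagate a b r g \<rho> s \<omega> * realize n (gauss_causal a b r) g s \<omega>))"
proof -
  let ?g = "g(s := \<lambda>\<omega>. g s \<omega> * h \<omega>)"
  have "propagate a b r ?g \<rho> s = propagate a b r g \<rho> s"
    by (intro propagate_cong) auto
  moreover have "ess_bounded (?g i)" if "i \<le> n" for i
    using g[OF that] h by (auto intro: ess_bounded_mult)
  ultimately show ?thesis
    using realize_duality[OF \<rho> s r, where g = ?g and a = a and b = b] realize_fun_upd_mult[OF s, of "gauss_causal a b r" g h]
    by (simp add: mult.assoc mult.commute[of "h _"])
qed

section \<open>Uniform convergence of realizations\<close>

lemma measurable_realize:
  assumes "t \<le> n" "\<And>i. i \<le> n \<Longrightarrow> g i \<in> borel_measurable lebesgue"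
  shows "realize n (gauss_causal a b r) g t \<in> borel_measurable lebesgue"
  using assms(1)
proof (induction t rule: inc_induct)
  case base
  then show ?case using assms(2) by (simp add: realize_last)
next
  case (step t)
  then have [measurable]: "g t \<in> borel_measurable lebesgue" using assms(2) by auto
  note step.IH[measurable]
  note measurable_gauss_causal[measurable]
  have "t < n" using step.hyps by simp
  then show ?case unfolding realize_step[OF \<open>t < n\<close>] by measurable
qed

text \<open>Averaging against a probability density contracts the sup norm. Boundedness of
  \<open>l\<close> makes \<open>f z\<close> bounded as soon as it is uniformly close to
  \<open>l\<close>, so that the two integrals may be subtracted.\<close>

lemma uniform_limit_gauss_average:
  assumes F: "uniform_limit UNIV f l F" and "\<sigma> > 0"
    and f: "\<forall>\<^sub>F z in F. f z \<in> borel_measurable lebesgue"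
    and l: "l \<in> borel_measurable lebesgue" "bounded (range l)"
  shows "uniform_limit UNIV (\<lambda>z \<omega>. LINT y|lebesgue. normal_density (\<alpha> * \<omega> + \<beta>) \<sigma> y * f z y)
    (\<lambda>\<omega>. LINT y|lebesgue. normal_density (\<alpha> * \<omega> + \<beta>) \<sigma> y * l y) F"
proof (rule uniform_limitI)
  fix e :: real assume "e > 0"
  \<comment> \<open>Integration preserves only the weak inequality, hence \<open>e / 2\<close> in
    place of \<open>e\<close>.\<close>
  then have "\<forall>\<^sub>F z in F. \<forall>y. dist (f z y) (l y) < e / 2"
    using F by (auto dest: uniform_limitD[of _ _ _ _ "e / 2"])
  with f show "\<forall>\<^sub>F z in F. \<forall>\<omega>\<in>UNIV. dist (LINT y|lebesgue. normal_density (\<alpha> * \<omega> + \<beta>) \<sigma> y * f z y)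
      (LINT y|lebesgue. normal_density (\<alpha> * \<omega> + \<beta>) \<sigma> y * l y) < e"
  proof eventually_elim
    case (elim z)
    have d: "\<bar>f z y - l y\<bar> \<le> e / 2" for y
      using elim(2) by (auto simp: dist_real_def less_imp_le)
    obtain C where C: "\<bar>l y\<bar> \<le> C" for y
      using l(2) by (auto simp: bounded_iff)
    have "ess_bounded l" using C l(1) by (auto intro: ess_boundedI)
    moreover have "ess_bounded (\<lambda>y. f z y - l y)"
      using l(1) elim(1) by (intro ess_boundedI[OF _ d]) auto
    moreover have "\<bar>f z y\<bar> \<le> C + e / 2" for y
      using C[of y] d[of y] by linarith
    then have "ess_bounded (f z)" using elim(1) by (auto intro: ess_boundedI)
    ultimately have "(LINT y|lebesgue. normal_density (\<alpha> * \<omega> + \<beta>) \<sigma> y * f z y) -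
        (LINT y|lebesgue. normal_density (\<alpha> * \<omega> + \<beta>) \<sigma> y * l y) =
        (LINT y|lebesgue. normal_density (\<alpha> * \<omega> + \<beta>) \<sigma> y * (f z y - l y))" for \<omega>
      using assms(2) by (simp add: right_diff_distrib has_integral_gauss_kernel integrable_mult_ess_bounded)
    moreover have "\<bar>LINT y|lebesgue. normal_density (\<alpha> * \<omega> + \<beta>) \<sigma> y * (f z y - l y)\<bar> \<le> e / 2" for \<omega>
      using d l(1) elim(1) assms(2) by (intro gauss_average_bound) auto
    ultimately have "dist (LINT y|lebesgue. normal_density (\<alpha> * \<omega> + \<beta>) \<sigma> y * f z y)
        (LINT y|lebesgue. normal_density (\<alpha> * \<omega> + \<beta>) \<sigma> y * l y) \<le> e / 2" for \<omega>
      by (simp only: dist_real_def)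
    from le_less_trans[OF this] show ?case using \<open>e > 0\<close> by simp
  qed
qed

lemma uniform_limit_gauss_causal:
  assumes "uniform_limit UNIV f l F" and "r t > 0"
    and "\<forall>\<^sub>F z in F. f z \<in> borel_measurable lebesgue"
    and "l \<in> borel_measurable lebesgue" "bounded (range l)"
  shows "uniform_limit UNIV (\<lambda>z. gauss_causal a b r t (f z)) (gauss_causal a b r t l) F"
proof -
  have "gauss_causal a b r t g =
      (\<lambda>\<omega>. LINT y|lebesgue. normal_density (a t * \<omega> + b t) (r t) y * g y)" for g
    by (simp add: fun_eq_iff gauss_causal_def)
  with uniform_limit_gauss_average[OF assms] show ?thesis by simp
qed

text \<open>Products of uniform limits demand limits bounded at every point. Before the final time
  the causal factor supplies such a bound from an almost everywhere one.\<close>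

lemma bounded_range_realize:
  assumes "t \<le> n" "\<And>i. 1 \<le> i \<Longrightarrow> i \<le> n \<Longrightarrow> r i > 0"
    and g: "\<And>i. i \<le> n \<Longrightarrow> g i \<in> borel_measurable lebesgue" "\<And>i. i \<le> n \<Longrightarrow> bounded (range (g i))"
  shows "bounded (range (realize n (gauss_causal a b r) g t))"
proof (cases "t < n")
  case False
  with assms show ?thesis by (simp add: realize_last)
next
  case True
  have "ess_bounded (g i)" if "i \<le> n" for i
    using g[OF that] by (auto simp: bounded_iff intro: ess_boundedI)
  then have "ess_bounded (realize n (gauss_causal a b r) g (Suc t))"
    using True assms by (intro ess_bounded_realize) auto
  then obtain C where C: "AE y in lebesgue. \<bar>realize n (gauss_causal a b r) g (Suc t) y\<bar> \<le> C"
      and [measurable]: "realize n (gauss_causal a b r) g (Suc t) \<in> borel_measurable lebesgue"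
    by (auto simp: ess_bounded_def)
  have "\<bar>gauss_causal a b r (Suc t) (realize n (gauss_causal a b r) g (Suc t)) \<omega>\<bar> \<le> C" for \<omega>
    using C assms True by (intro gauss_causal_bound) auto
  moreover obtain D where "\<bar>g t \<omega>\<bar> \<le> D" for \<omega>
    using g(2)[of t] assms(1) by (auto simp: bounded_iff)
  ultimately have "\<bar>realize n (gauss_causal a b r) g t \<omega>\<bar> \<le> D * C" for \<omega>
    using True by (auto simp: realize_step abs_mult intro!: mult_mono intro: order_trans[OF abs_ge_zero])
  then show ?thesis by (auto simp: bounded_iff)
qed

text \<open>Going backward in time, the causal operator preserves uniform limits, and so does
  multiplication by the next weight because both limits are bounded.\<close>

lemma uniform_limit_realize:
  assumes "t \<le> n" "\<And>i. 1 \<le> i \<Longrightarrow> i \<le> n \<Longrightarrow> r i > 0"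
    and lim: "\<And>i. i \<le> n \<Longrightarrow> uniform_limit UNIV (\<lambda>z. g z i) (l i) F"
    and g: "\<forall>\<^sub>F z in F. \<forall>i\<le>n. g z i \<in> borel_measurable lebesgue"
    and l: "\<And>i. i \<le> n \<Longrightarrow> l i \<in> borel_measurable lebesgue" "\<And>i. i \<le> n \<Longrightarrow> bounded (range (l i))"
  shows "uniform_limit UNIV (\<lambda>z. realize n (gauss_causal a b r) (g z) t) (realize n (gauss_causal a b r) l t) F"
  using assms(1)
proof (induction t rule: inc_induct)
  case base
  then show ?case using lim by (simp add: realize_last)
next
  case (step t)
  let ?\<Phi> = "gauss_causal a b r"
  have "uniform_limit UNIV (\<lambda>z. ?\<Phi> (Suc t) (realize n ?\<Phi> (g z) (Suc t)))
      (?\<Phi> (Suc t) (realize n ?\<Phi> l (Suc t))) F"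
  proof (rule uniform_limit_gauss_causal)
    show "\<forall>\<^sub>F z in F. realize n ?\<Phi> (g z) (Suc t) \<in> borel_measurable lebesgue"
      using g by eventually_elim (use step.hyps in \<open>auto intro!: measurable_realize\<close>)
  qed (use step assms measurable_realize bounded_range_realize in auto)
  moreover have "bounded (range (?\<Phi> (Suc t) (realize n ?\<Phi> l (Suc t))))"
    \<comment> \<open>this factor is itself a realization, with weight 1 at time \<open>t\<close>\<close>
    using bounded_range_realize[of t n r "l(t := \<lambda>_. 1)" a b] step.hyps assms
      realize_cong[of "Suc t" n "l(t := \<lambda>_. 1)" l ?\<Phi>]
    by (auto simp: realize_step)
  ultimately show ?case
    using step.hyps lim[of t] l(2)[of t] by (auto simp: realize_step intro!: uniform_lim_mult)
qed

lemma tendsto_realize: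
  assumes "\<And>i. 1 \<le> i \<Longrightarrow> i \<le> n \<Longrightarrow> r i > 0" "\<sigma> > 0"
    and lim: "\<And>i. i \<le> n \<Longrightarrow> uniform_limit UNIV (\<lambda>z. g z i) (l i) F"
    and g: "\<forall>\<^sub>F z in F. \<forall>i\<le>n. g z i \<in> borel_measurable lebesgue"
    and l: "\<And>i. i \<le> n \<Longrightarrow> l i \<in> borel_measurable lebesgue" "\<And>i. i \<le> n \<Longrightarrow> bounded (range (l i))"
  shows "((\<lambda>z. LINT \<omega>|lebesgue. realize n (gauss_causal a b r) (g z) 0 \<omega> * normal_density \<mu> \<sigma> \<omega>) \<longlongrightarrow>
    (LINT \<omega>|lebesgue. realize n (gauss_causal a b r) l 0 \<omega> * normal_density \<mu> \<sigma> \<omega>)) F"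
proof -
  let ?\<Phi> = "gauss_causal a b r"
  \<comment> \<open>The pairing with the initial state is a Gaussian average of slope 0, constant in
    \<open>\<omega>\<close>, so \<open>uniform_limit_gauss_average\<close> covers it as
    well.\<close>
  have "uniform_limit UNIV
      (\<lambda>z \<omega>. LINT y|lebesgue. normal_density (0 * \<omega> + \<mu>) \<sigma> y * realize n ?\<Phi> (g z) 0 y)
      (\<lambda>\<omega>. LINT y|lebesgue. normal_density (0 * \<omega> + \<mu>) \<sigma> y * realize n ?\<Phi> l 0 y) F"
  proof (rule uniform_limit_gauss_average)
    show "uniform_limit UNIV (\<lambda>z. realize n ?\<Phi> (g z) 0) (realize n ?\<Phi> l 0) F"
      using assms by (intro uniform_limit_realize) auto
    show "\<forall>\<^sub>F z in F. realize n ?\<Phi> (g z) 0 \<in> borel_measurable lebesgue"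
      using g by eventually_elim (auto intro!: measurable_realize)
  qed (use assms measurable_realize bounded_range_realize in auto)
  from tendsto_uniform_limitI[OF this, of 0] show ?thesis
    by (simp add: mult.commute)
qed

section \<open>The forward and backward recursions\<close>

text \<open>The factor \<open>k\<close> is the product of the predictive densities of the values
  measured before time \<open>t\<close>, which the forward recursion drops. Positivity of the
  variance is carried along since the Gaussian product formula assumes it.\<close>

lemma propagate_gauss:
  assumes "\<sigma>0 > 0" "t \<le> n" and q: "\<And>i. i \<le> n \<Longrightarrow> q i > 0"
    and r: "\<And>i. 1 \<le> i \<Longrightarrow> i \<le> n \<Longrightarrow> r i > 0"
  shows "snd (forward \<mu>0 \<sigma>0 c d q a b r x t) > 0 \<and>
    (\<exists>k>0. propagate a b r (\<lambda>i \<omega>. normal_density (c i * \<omega> + d i) (q i) (x i)) (normal_density \<mu>0 \<sigma>0) t =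
      (\<lambda>\<omega>. k * forward_density \<mu>0 \<sigma>0 c d q a b r x t \<omega>))"
  using assms(2)
proof (induction t)
  case 0
  have "normal_density \<mu>0 \<sigma>0 = (\<lambda>\<omega>. 1 * forward_density \<mu>0 \<sigma>0 c d q a b r x 0 \<omega>)"
    using assms(1) by (simp add: forward_density_def)
  with assms(1) show ?case by (auto intro: exI[of _ 1])
next
  case (Suc t)
  let ?P = "propagate a b r (\<lambda>i \<omega>. normal_density (c i * \<omega> + d i) (q i) (x i)) (normal_density \<mu>0 \<sigma>0)"
  obtain \<mu> v where fw: "forward \<mu>0 \<sigma>0 c d q a b r x t = (\<mu>, v)" by fastforce
  with Suc obtain k where v: "v > 0" and k: "k > 0"
    and P: "?P t = (\<lambda>\<omega>. k * normal_density \<mu> (sqrt v) \<omega>)"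
    by (auto simp: forward_density_def)
  have qt: "q t > 0" and rt: "r (Suc t) > 0" using Suc.prems q r by auto
  define v' where "v' = (q t)\<^sup>2 * v / ((q t)\<^sup>2 + (c t)\<^sup>2 * v)"
  define \<mu>' where "\<mu>' = \<mu> + v' * (c t / (q t)\<^sup>2) * (x t - d t - c t * \<mu>)"
  \<comment> \<open>The predictive density of the value measured at time \<open>t\<close>.\<close>
  define k' where "k' = normal_density (c t * \<mu> + d t) (sqrt ((c t)\<^sup>2 * v + (q t)\<^sup>2)) (x t)"
  have fw': "forward \<mu>0 \<sigma>0 c d q a b r x (Suc t) =
      (a (Suc t) * \<mu>' + b (Suc t), (a (Suc t))\<^sup>2 * v' + (r (Suc t))\<^sup>2)"
    by (simp only: forward.simps fw Let_def prod.case \<mu>'_def v'_def)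
  have v': "v' > 0"
    unfolding v'_def using v qt by (intro divide_pos_pos add_pos_nonneg mult_pos_pos) auto
  have k': "k' > 0"
    unfolding k'_def using v qt by (intro normal_density_pos) (auto intro: add_nonneg_pos)
  have prod: "normal_density \<mu> (sqrt v) \<omega> * normal_density (c t * \<omega> + d t) (q t) (x t) =
      k' * normal_density \<mu>' (sqrt v') \<omega>" for \<omega>
    unfolding k'_def \<mu>'_def v'_def using v qt by (rule normal_density_mult_linear)
  have "?P (Suc t) y = k * k' * forward_density \<mu>0 \<sigma>0 c d q a b r x (Suc t) y" for y
  proof -
    have "k * normal_density \<mu> (sqrt v) \<omega> * normal_density (c t * \<omega> + d t) (q t) (x t) =
        k * k' * normal_density \<mu>' (sqrt v') \<omega>" for \<omega>
      by (simp only: prod mult.assoc)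
    then have "?P (Suc t) y = (LINT \<omega>|lebesgue. k * k' *
        (normal_density \<mu>' (sqrt v') \<omega> * normal_density (a (Suc t) * \<omega> + b (Suc t)) (r (Suc t)) y))"
      by (simp only: propagate.simps P mult.assoc)
    also have "\<dots> = k * k' * normal_density (a (Suc t) * \<mu>' + b (Suc t)) (sqrt ((a (Suc t))\<^sup>2 * v' + (r (Suc t))\<^sup>2)) y"
      using v' rt by (simp add: integral_normal_density_mult_linear)
    finally show ?thesis
      by (simp only: forward_density_def fw' Let_def prod.case)
  qed
  moreover have "0 < snd (forward \<mu>0 \<sigma>0 c d q a b r x (Suc t))"
    using v' rt by (simp only: fw' snd_conv) (simp add: add_nonneg_pos)
  ultimately show ?case using k k' by (intro conjI exI[of _ "k * k'"]) auto
qed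

text \<open>The exponential is \<open>sqrt (2 * pi)\<close> times the density at \<open>V\<close> of
  a unit Gaussian with mean \<open>U * y\<close>, so the average is the marginal density of an
  observation with noise 1. This covers \<open>U = 0\<close> too, where the exponential is constant
  in \<open>y\<close>.\<close>

lemma gauss_average_exp_square:
  assumes "r > 0"
  shows "(LINT y|lebesgue. normal_density \<mu> r y * exp (- (1/2) * (U * y - V)\<^sup>2)) =
    1 / sqrt (1 + r\<^sup>2 * U\<^sup>2) * exp (- (1/2) * ((U * \<mu> - V) / sqrt (1 + r\<^sup>2 * U\<^sup>2))\<^sup>2)"
proof -
  define w where "w = 1 + r\<^sup>2 * U\<^sup>2"
  have w: "w > 0" unfolding w_def by (intro add_pos_nonneg) auto
  have r: "sqrt (r\<^sup>2) = r" using assms by simp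
  have "exp (- (1/2) * (U * y - V)\<^sup>2) = sqrt (2 * pi) * normal_density (U * y + 0) 1 V" for y
    by (simp add: normal_density_def power2_commute)
  then have "(LINT y|lebesgue. normal_density \<mu> r y * exp (- (1/2) * (U * y - V)\<^sup>2)) =
      (LINT y|lebesgue. sqrt (2 * pi) * (normal_density \<mu> (sqrt (r\<^sup>2)) y * normal_density (U * y + 0) 1 V))"
    by (simp only: r mult.left_commute)
  also have "\<dots> = sqrt (2 * pi) * (LINT y|lebesgue. normal_density \<mu> (sqrt (r\<^sup>2)) y * normal_density (U * y + 0) 1 V)"
    by (rule integral_mult_right_zero)
  also have "\<dots> = sqrt (2 * pi) * normal_density (U * \<mu> + 0) (sqrt (U\<^sup>2 * r\<^sup>2 + 1\<^sup>2)) V"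
    using assms by (subst integral_normal_density_mult_linear) auto
  also have "U\<^sup>2 * r\<^sup>2 + 1\<^sup>2 = w" by (simp add: w_def mult.commute)
  also have "sqrt (2 * pi) * normal_density (U * \<mu> + 0) (sqrt w) V =
      1 / sqrt w * exp (- (1/2) * ((U * \<mu> - V) / sqrt w)\<^sup>2)"
    using w by (simp add: normal_density_def power_divide real_sqrt_mult power2_commute[of V])
  finally show ?thesis unfolding w_def .
qed

text \<open>The square is completed in the sum of two quadratic exponents. Comparing coefficients of
  \<open>\<omega>^2\<close> and \<open>\<omega>\<close> forces \<open>U^2 = c^2 / q^2 + u^2\<close>
  and \<open>U * V = c * (x - d) / q^2 + u * v\<close>; the remainder is constant in
  \<open>\<omega>\<close>.\<close>

lemma normal_density_mult_exp_square:
  fixes c d q x u v :: real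
  assumes "q > 0"
  defines "U \<equiv> sqrt (c\<^sup>2 + u\<^sup>2 * q\<^sup>2) / q"
    and "V \<equiv> (c * (x - d) + u * v * q\<^sup>2) / (q * sqrt (c\<^sup>2 + u\<^sup>2 * q\<^sup>2))"
  shows "normal_density (c * \<omega> + d) q x * exp (- (1/2) * (u * \<omega> - v)\<^sup>2) =
    1 / sqrt (2 * pi * q\<^sup>2) * exp (- (1/2) * ((x - d)\<^sup>2 / q\<^sup>2 + v\<^sup>2 - V\<^sup>2)) * exp (- (1/2) * (U * \<omega> - V)\<^sup>2)"
proof -
  have UU: "U\<^sup>2 * q\<^sup>2 = c\<^sup>2 + u\<^sup>2 * q\<^sup>2"
    using assms(1) by (simp add: U_def power_divide)
  have UV: "U * V * q\<^sup>2 = c * (x - d) + u * v * q\<^sup>2"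
  proof (cases "c\<^sup>2 + u\<^sup>2 * q\<^sup>2 = 0")
    \<comment> \<open>For \<open>c = u = 0\<close> the linear coefficient vanishes together with
      \<open>U\<close>, so the default value 0 of \<open>V\<close> does no harm.\<close>
    case True
    then have "c = 0" "u = 0"
      using assms(1) by (auto simp: add_nonneg_eq_0_iff)
    then show ?thesis by (simp add: U_def)
  next
    case False
    then have "sqrt (c\<^sup>2 + u\<^sup>2 * q\<^sup>2) \<noteq> 0" by simp
    then have "U * V = (c * (x - d) + u * v * q\<^sup>2) / q\<^sup>2"
      unfolding U_def V_def by (simp add: power2_eq_square)
    then show ?thesis using assms(1) by simp
  qed
  have "(x - (c * \<omega> + d))\<^sup>2 / q\<^sup>2 + (u * \<omega> - v)\<^sup>2 = (x - d)\<^sup>2 / q\<^sup>2 + v\<^sup>2 - V\<^sup>2 + (U * \<omega> - V)\<^sup>2"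
  proof -
    have "(x - (c * \<omega> + d))\<^sup>2 + (u * \<omega> - v)\<^sup>2 * q\<^sup>2 =
        (x - d)\<^sup>2 + v\<^sup>2 * q\<^sup>2 - V\<^sup>2 * q\<^sup>2 + (U\<^sup>2 * q\<^sup>2 * \<omega>\<^sup>2 - 2 * \<omega> * (U * V * q\<^sup>2) + V\<^sup>2 * q\<^sup>2)"
      unfolding UU UV by algebra
    also have "\<dots> = (x - d)\<^sup>2 + (v\<^sup>2 - V\<^sup>2 + (U * \<omega> - V)\<^sup>2) * q\<^sup>2"
      by algebra
    finally show ?thesis using assms(1) by (simp add: field_simps)
  qed
  then have "exp (- (x - (c * \<omega> + d))\<^sup>2 / (2 * q\<^sup>2)) * exp (- (1/2) * (u * \<omega> - v)\<^sup>2) =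
      exp (- (1/2) * ((x - d)\<^sup>2 / q\<^sup>2 + v\<^sup>2 - V\<^sup>2)) * exp (- (1/2) * (U * \<omega> - V)\<^sup>2)"
    unfolding exp_add[symmetric] by (simp add: field_simps)
  then show ?thesis unfolding normal_density_def by simp
qed

text \<open>Exponentials of minus half the square of an affine function are closed under causal
  operators and under multiplication by Gaussian observation densities, up to constants free of
  \<open>\<omega>\<close>, which \<open>k\<close> collects.\<close>

lemma realize_gauss:
  assumes "t \<le> n" and q: "\<And>i. i \<le> n \<Longrightarrow> q i > 0"
    and r: "\<And>i. 1 \<le> i \<Longrightarrow> i \<le> n \<Longrightarrow> r i > 0"
  shows "\<exists>k>0. realize n (gauss_causal a b r) (\<lambda>i \<omega>. normal_density (c i * \<omega> + d i) (q i) (x i)) t =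
      (\<lambda>\<omega>. k * backward_likelihood n c d q a b r x t \<omega>)"
  using assms(1)
proof (induction t rule: inc_induct)
  case base
  have "q n > 0" using q by simp
  have "normal_density (c n * \<omega> + d n) (q n) (x n) =
      1 / sqrt (2 * pi * (q n)\<^sup>2) * backward_likelihood n c d q a b r x n \<omega>" for \<omega>
  proof -
    have "c n / q n * \<omega> - (x n - d n) / q n = - ((x n - (c n * \<omega> + d n)) / q n)"
      using \<open>q n > 0\<close> by (simp add: field_simps)
    then have "(c n / q n * \<omega> - (x n - d n) / q n)\<^sup>2 = (x n - (c n * \<omega> + d n))\<^sup>2 / (q n)\<^sup>2"
      by (simp only: power2_minus power_divide)
    then show ?thesis using \<open>q n > 0\<close>
      by (simp add: backward_likelihood_def backward.simps[of n c d q a b r x n] normal_density_def)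
  qed
  moreover have "0 < 1 / sqrt (2 * pi * (q n)\<^sup>2)" using \<open>q n > 0\<close> by simp
  ultimately show ?case by (auto simp only: realize_last)
next
  case (step t)
  let ?R = "realize n (gauss_causal a b r) (\<lambda>i \<omega>. normal_density (c i * \<omega> + d i) (q i) (x i))"
  obtain U V where bw: "backward n c d q a b r x (Suc t) = (U, V)" by fastforce
  with step.IH obtain k where k: "k > 0" and R: "?R (Suc t) = (\<lambda>\<omega>. k * exp (- (1/2) * (U * \<omega> - V)\<^sup>2))"
    by (auto simp: backward_likelihood_def)
  have tn: "t < n" using step.hyps by simp
  have qt: "q t > 0" and rt: "r (Suc t) > 0" using tn q r by auto
  define w where "w = sqrt (1 + (r (Suc t))\<^sup>2 * U\<^sup>2)"
  have w: "w > 0" unfolding w_def real_sqrt_gt_0_iff by (intro add_pos_nonneg) auto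
  define u where "u = - (a (Suc t) * U / w)"
  define v where "v = (b (Suc t) * U - V) / w"
  define V' where "V' = (c t * (x t - d t) + u * v * (q t)\<^sup>2) / (q t * sqrt ((c t)\<^sup>2 + u\<^sup>2 * (q t)\<^sup>2))"
  define k' where "k' = 1 / sqrt (2 * pi * (q t)\<^sup>2) * exp (- (1/2) * ((x t - d t)\<^sup>2 / (q t)\<^sup>2 + v\<^sup>2 - V'\<^sup>2))"
  have "gauss_causal a b r (Suc t) (?R (Suc t)) \<omega> = k / w * exp (- (1/2) * (u * \<omega> - v)\<^sup>2)" for \<omega>
  proof -
    have "gauss_causal a b r (Suc t) (?R (Suc t)) \<omega> =
        k * (LINT y|lebesgue. normal_density (a (Suc t) * \<omega> + b (Suc t)) (r (Suc t)) y * exp (- (1/2) * (U * y - V)\<^sup>2))"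
      by (simp add: R gauss_causal_def mult.left_commute)
    also have "\<dots> = k / w * exp (- (1/2) * ((U * (a (Suc t) * \<omega> + b (Suc t)) - V) / w)\<^sup>2)"
      by (simp only: gauss_average_exp_square[OF rt] w_def) simp
    \<comment> \<open>The recursion takes \<open>u\<close> and \<open>v\<close> with the opposite
      sign of this affine function; the square hides it.\<close>
    also have "(U * (a (Suc t) * \<omega> + b (Suc t)) - V) / w = - (u * \<omega> - v)"
      using w by (simp add: u_def v_def field_simps)
    finally show ?thesis by (simp only: power2_minus)
  qed
  then have 1: "?R t \<omega> = k / w * (normal_density (c t * \<omega> + d t) (q t) (x t) * exp (- (1/2) * (u * \<omega> - v)\<^sup>2))" for \<omega>
    using tn by (simp add: realize_step)
  have "backward n c d q a b r x t = (sqrt ((c t)\<^sup>2 + u\<^sup>2 * (q t)\<^sup>2) / q t, V')"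
    using tn by (simp add: backward.simps[of n c d q a b r x t] bw Let_def u_def v_def w_def V'_def)
  then have "backward_likelihood n c d q a b r x t \<omega> =
      exp (- (1/2) * (sqrt ((c t)\<^sup>2 + u\<^sup>2 * (q t)\<^sup>2) / q t * \<omega> - V')\<^sup>2)" for \<omega>
    by (simp add: backward_likelihood_def)
  then have "?R t = (\<lambda>\<omega>. k / w * k' * backward_likelihood n c d q a b r x t \<omega>)"
    by (intro ext) (simp only: 1 normal_density_mult_exp_square[OF qt] k'_def V'_def mult.assoc)
  moreover have "k / w * k' > 0" using k w qt by (simp add: k'_def)
  ultimately show ?case by blast
qed

section \<open>Shrinking intervals\<close>

text \<open>The sets generating the filter shrink with \<open>e\<close>, so they form a base:
  \<open>min e e'\<close> serves two radii at once.\<close>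

lemma eventually_shrinking_intervals:
  "eventually P (shrinking_intervals n x) \<longleftrightarrow> (\<exists>e>0. \<forall>\<Xi>. (\<forall>t\<le>n. is_interval (\<Xi> t) \<and> x t \<in> \<Xi> t \<and>
        0 < emeasure lebesgue (\<Xi> t) \<and> emeasure lebesgue (\<Xi> t) < ennreal e) \<longrightarrow> P \<Xi>)"
proof -
  have "eventually P (shrinking_intervals n x) \<longleftrightarrow>
    (\<exists>e\<in>{0<..}. eventually P (principal {\<Xi>. \<forall>t\<le>n. is_interval (\<Xi> t) \<and> x t \<in> \<Xi> t \<and>
        0 < emeasure lebesgue (\<Xi> t) \<and> emeasure lebesgue (\<Xi> t) < ennreal e}))"
    unfolding shrinking_intervals_def
  proof (rule eventually_INF_base)
    fix e e' :: real assume "e \<in> {0<..}" "e' \<in> {0<..}"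
    then show "\<exists>e''\<in>{0<..}. principal {\<Xi>. \<forall>t\<le>n. is_interval (\<Xi> t) \<and> x t \<in> \<Xi> t \<and>
          0 < emeasure lebesgue (\<Xi> t) \<and> emeasure lebesgue (\<Xi> t) < ennreal e''}
        \<le> inf (principal {\<Xi>. \<forall>t\<le>n. is_interval (\<Xi> t) \<and> x t \<in> \<Xi> t \<and>
          0 < emeasure lebesgue (\<Xi> t) \<and> emeasure lebesgue (\<Xi> t) < ennreal e})
          (principal {\<Xi>. \<forall>t\<le>n. is_interval (\<Xi> t) \<and> x t \<in> \<Xi> t \<and>
          0 < emeasure lebesgue (\<Xi> t) \<and> emeasure lebesgue (\<Xi> t) < ennreal e'})"
      by (intro bexI[of _ "min e e'"])
        (auto simp: le_principal eventually_principal intro: less_le_trans ennreal_leI)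
  qed auto
  then show ?thesis by (auto simp: eventually_principal)
qed

text \<open>Makes limits along the filter unique. Length \<open>e / 2\<close> meets both strict
  bounds on the measure.\<close>

lemma shrinking_intervals_neq_bot: "shrinking_intervals n x \<noteq> bot"
proof -
  have "\<exists>\<Xi>. \<forall>t\<le>n. is_interval (\<Xi> t) \<and> x t \<in> \<Xi> t \<and>
        0 < emeasure lebesgue (\<Xi> t) \<and> emeasure lebesgue (\<Xi> t) < ennreal e" if "e > 0" for e
    using that by (intro exI[of _ "\<lambda>t. {x t..x t + e / 2}"]) (auto simp: is_interval_cc ennreal_lessI)
  then show ?thesis
    unfolding trivial_limit_def eventually_shrinking_intervals by blast
qed

section \<open>Gaussian observables on short intervals\<close>

lemma gauss_obs_eq: "gauss_obs c d q t S \<omega> =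
    (LINT y|lebesgue. normal_density (c t * \<omega> + d t) (q t) y * indicator S y)"
  by (simp add: gauss_obs_def set_lebesgue_integral_def mult.commute)

lemma ess_bounded_gauss_obs:
  assumes "q t > 0" and [measurable]: "S \<in> sets lebesgue"
  shows "ess_bounded (gauss_obs c d q t S)"
proof (rule ess_boundedI)
  show "gauss_obs c d q t S \<in> borel_measurable lebesgue"
    unfolding gauss_obs_eq by measurable
  show "\<bar>gauss_obs c d q t S \<omega>\<bar> \<le> 1" for \<omega>
    unfolding gauss_obs_eq using assms(1) by (intro gauss_average_bound) (auto simp: indicator_def)
qed

text \<open>The Gaussian density never vanishes, so a zero integral over \<open>S\<close> would make
  \<open>S\<close> a null set.\<close>

lemma gauss_obs_pos:
  assumes "q t > 0" and S [measurable]: "S \<in> sets lebesgue" and "0 < emeasure lebesgue S"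
  shows "0 < gauss_obs c d q t S \<omega>"
proof -
  have "gauss_obs c d q t S \<omega> \<noteq> 0"
  proof
    have "integrable lebesgue (\<lambda>y. normal_density (c t * \<omega> + d t) (q t) y * indicator S y)"
      using assms(1) by (intro integrable_mult_ess_bounded has_integral_gauss_kernel ess_boundedI[of _ 1])
        (auto simp: indicator_def)
    moreover assume "gauss_obs c d q t S \<omega> = 0"
    ultimately have "AE y in lebesgue. normal_density (c t * \<omega> + d t) (q t) y * indicator S y = 0"
      unfolding gauss_obs_eq by (subst (asm) integral_nonneg_eq_0_iff_AE) auto
    then have "AE y in lebesgue. y \<notin> S"
      by eventually_elim (metis indicator_simps(1) less_irrefl mult.right_neutral normal_density_pos[OF assms(1)])
    then have "S \<in> null_sets lebesgue"
      using AE_iff_null_sets[OF S] by simp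
    with assms(3) show False by (auto dest: null_setsD1)
  qed
  moreover have "0 \<le> gauss_obs c d q t S \<omega>"
    unfolding gauss_obs_eq by (intro integral_nonneg_AE) auto
  ultimately show ?thesis by simp
qed

lemma is_interval_dist_le_measure:
  fixes S :: "real set"
  assumes "is_interval S" "y \<in> S" "z \<in> S" "emeasure lebesgue S < \<infinity>"
  shows "\<bar>y - z\<bar> \<le> measure lebesgue S"
proof -
  have "u - v \<le> measure lebesgue S" if "v \<le> u" "u \<in> S" "v \<in> S" for u v
  proof -
    have "{v..u} \<subseteq> S"
      using mem_is_interval_1_I[OF assms(1) that(3) that(2)] by auto
    moreover have "S \<in> lmeasurable"
      using real_interval_borel_measurable[OF assms(1)] assms(4) by (intro fmeasurableI) simp_all
    ultimately have "measure lebesgue {v..u} \<le> measure lebesgue S"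
      by (intro measure_mono_fmeasurable) simp_all
    with that(1) show ?thesis by simp
  qed
  then have "y - z \<le> measure lebesgue S \<or> y < z" "z - y \<le> measure lebesgue S \<or> z < y"
    using assms(2,3) by (meson not_le_imp_less)+
  then show ?thesis
    using measure_nonneg[of lebesgue S] by linarith
qed

text \<open>Averaging the density over \<open>S\<close> instead of evaluating it at \<open>x\<close>
  costs at most its Lipschitz constant times the largest distance within \<open>S\<close>, which the
  length bounds. The estimate is free of \<open>\<omega>\<close>.\<close>

lemma gauss_obs_approx:
  assumes q: "q t > 0" and S: "is_interval S" "x \<in> S"
    and "0 < emeasure lebesgue S" "emeasure lebesgue S < \<infinity>"
  shows "\<bar>gauss_obs c d q t S \<omega> / measure lebesgue S - normal_density (c t * \<omega> + d t) (q t) x\<bar>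
    \<le> measure lebesgue S / (q t)\<^sup>2"
proof -
  let ?N = "normal_density (c t * \<omega> + d t) (q t)" and ?m = "measure lebesgue S"
  have m: "?m > 0" using assms(4,5) by (simp add: measure_def enn2real_positive_iff)
  have [measurable]: "S \<in> sets lebesgue"
    using real_interval_borel_measurable[OF S(1)] by simp
  have ind: "integrable lebesgue (indicator S :: real \<Rightarrow> real)"
    using assms(5) by (intro integrable_real_indicator) auto
  have iN: "integrable lebesgue (\<lambda>y. ?N y * indicator S y)"
    using q by (intro integrable_mult_ess_bounded has_integral_gauss_kernel ess_boundedI[of _ 1])
      (auto simp: indicator_def)
  have "gauss_obs c d q t S \<omega> - ?m * ?N x = (LINT y|lebesgue. ?N y * indicator S y) - (LINT y|lebesgue. ?N x * indicator S y)"
    by (simp add: gauss_obs_eq)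
  also have "\<dots> = (LINT y|lebesgue. ?N y * indicator S y - ?N x * indicator S y)"
    using iN ind by (intro Bochner_Integration.integral_diff[symmetric]) auto
  finally have "\<bar>gauss_obs c d q t S \<omega> - ?m * ?N x\<bar> \<le> (LINT y|lebesgue. \<bar>?N y * indicator S y - ?N x * indicator S y\<bar>)"
    using integral_norm_bound[of lebesgue "\<lambda>y. ?N y * indicator S y - ?N x * indicator S y"] by simp
  also have "\<dots> \<le> (LINT y|lebesgue. ?m / (q t)\<^sup>2 * indicator S y)"
  proof (rule integral_mono)
    fix y :: real
    have "\<bar>?N y - ?N x\<bar> \<le> ?m / (q t)\<^sup>2" if "y \<in> S"
      using normal_density_lipschitz[OF q, of "c t * \<omega> + d t" y x]
        is_interval_dist_le_measure[OF S(1) that S(2) assms(5)]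
      by (meson divide_right_mono order_trans zero_le_power2)
    then show "\<bar>?N y * indicator S y - ?N x * indicator S y\<bar> \<le> ?m / (q t)\<^sup>2 * indicator S y"
      by (auto simp: indicator_def)
  qed (use iN ind in auto)
  also have "\<dots> = ?m / (q t)\<^sup>2 * ?m" by simp
  finally have "\<bar>gauss_obs c d q t S \<omega> - ?m * ?N x\<bar> / ?m \<le> ?m / (q t)\<^sup>2"
    using m by (simp only: pos_divide_le_eq)
  moreover have "gauss_obs c d q t S \<omega> / ?m - ?N x = (gauss_obs c d q t S \<omega> - ?m * ?N x) / ?m"
    using m by (simp add: diff_divide_distrib)
  ultimately show ?thesis using m by (simp only: abs_divide abs_of_pos)
qed

lemma uniform_limit_gauss_obs:
  assumes "q t > 0" "t \<le> n"
  shows "uniform_limit UNIV (\<lambda>\<Xi> \<omega>. gauss_obs c d q t (\<Xi> t) \<omega> / measure lebesgue (\<Xi> t))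
    (\<lambda>\<omega>. normal_density (c t * \<omega> + d t) (q t) (x t)) (shrinking_intervals n x)"
proof (rule uniform_limitI)
  fix e :: real assume "e > 0"
  \<comment> \<open>The threshold is read off from \<open>gauss_obs_approx\<close>: lengths below
    \<open>e * (q t)^2\<close> give errors below \<open>e\<close>.\<close>
  then have e: "e * (q t)\<^sup>2 > 0" using assms by simp
  show "\<forall>\<^sub>F \<Xi> in shrinking_intervals n x. \<forall>\<omega>\<in>UNIV. dist (gauss_obs c d q t (\<Xi> t) \<omega> / measure lebesgue (\<Xi> t))
      (normal_density (c t * \<omega> + d t) (q t) (x t)) < e"
    unfolding eventually_shrinking_intervals
  proof (intro exI[of _ "e * (q t)\<^sup>2"] conjI e allI impI ballI)
    fix \<Xi> :: "nat \<Rightarrow> real set" and \<omega> :: real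
    assume "\<forall>t'\<le>n. is_interval (\<Xi> t') \<and> x t' \<in> \<Xi> t' \<and>
        0 < emeasure lebesgue (\<Xi> t') \<and> emeasure lebesgue (\<Xi> t') < ennreal (e * (q t)\<^sup>2)"
    with assms(2) have \<Xi>: "is_interval (\<Xi> t)" "x t \<in> \<Xi> t" "0 < emeasure lebesgue (\<Xi> t)"
      "emeasure lebesgue (\<Xi> t) < ennreal (e * (q t)\<^sup>2)" by auto
    then have fin: "emeasure lebesgue (\<Xi> t) < \<infinity>"
      by (metis ennreal_less_top infinity_ennreal_def less_trans)
    then have "emeasure lebesgue (\<Xi> t) = ennreal (measure lebesgue (\<Xi> t))"
      by (intro emeasure_eq_ennreal_measure) auto
    from \<Xi>(4)[unfolded this] have "measure lebesgue (\<Xi> t) < e * (q t)\<^sup>2"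
      by (rule ennreal_less_iff[OF measure_nonneg, THEN iffD1])
    then have "measure lebesgue (\<Xi> t) / (q t)\<^sup>2 < e"
      using assms(1) by (simp add: pos_divide_less_eq)
    from le_less_trans[OF gauss_obs_approx[of q t, OF assms(1) \<Xi>(1-3) fin] this, of c d \<omega>]
    show "dist (gauss_obs c d q t (\<Xi> t) \<omega> / measure lebesgue (\<Xi> t))
      (normal_density (c t * \<omega> + d t) (q t) (x t)) < e"
      by (simp only: dist_real_def)
  qed
qed

section \<open>Test observables\<close>

text \<open>The sharp yes-no measurement of membership in \<open>E\<close>. Countable additivity
  reduces to the two outcomes: each lies in at most one member of a disjoint family, so its series
  has at most one nonzero term.\<close>

lemma bool_observable:
  assumes [measurable]: "E \<in> sets lebesgue"
  shows "observable (UNIV :: bool set) UNIV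
    (\<lambda>\<Gamma> \<omega>. of_bool (True \<in> \<Gamma>) * indicator E \<omega> + of_bool (False \<in> \<Gamma>) * (1 - indicator E \<omega>))"
    (is "observable _ _ ?G")
  unfolding observable_def
proof (intro conjI allI impI ballI)
  show "sigma_algebra (UNIV :: bool set) UNIV"
    using sigma_algebra_Pow[of "UNIV :: bool set"] by simp
next
  fix A :: "nat \<Rightarrow> bool set" and \<rho> :: "real \<Rightarrow> real"
  assume A: "range A \<subseteq> UNIV \<and> disjoint_family A" and \<rho>: "integrable lebesgue \<rho>"
  have sums: "(\<lambda>i. of_bool (z \<in> A i)) sums (of_bool (z \<in> (\<Union>i. A i)) :: real)" for z
  proof (cases "z \<in> (\<Union>i. A i)")
    case True
    then obtain j where j: "z \<in> A j" by auto
    then have "(\<lambda>i. of_bool (z \<in> A i)) = (\<lambda>i. if i = j then 1 else 0 :: real)"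
      using A by (auto simp: disjoint_family_on_def fun_eq_iff)
    with True sums_single[of j "\<lambda>_. 1 :: real"] show ?thesis by simp
  qed auto
  have "ess_bounded (indicator E)" "ess_bounded (\<lambda>\<omega>. 1 - indicator E \<omega>)"
    by (auto intro!: ess_boundedI[of _ 1] simp: indicator_def)
  then have "integrable lebesgue (\<lambda>\<omega>. indicator E \<omega> * \<rho> \<omega>)" "integrable lebesgue (\<lambda>\<omega>. (1 - indicator E \<omega>) * \<rho> \<omega>)"
    using integrable_mult_ess_bounded[OF \<rho>] by (simp_all add: mult.commute[of _ "\<rho> _"])
  then have eq: "(LINT \<omega>|lebesgue. ?G \<Gamma> \<omega> * \<rho> \<omega>) = of_bool (True \<in> \<Gamma>) * (LINT \<omega>|lebesgue. indicator E \<omega> * \<rho> \<omega>) +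
      of_bool (False \<in> \<Gamma>) * (LINT \<omega>|lebesgue. (1 - indicator E \<omega>) * \<rho> \<omega>)" for \<Gamma>
    by (simp only: distrib_right mult.assoc Bochner_Integration.integral_add integrable_mult_right integral_mult_right_zero)
  show "(\<lambda>i. LINT \<omega>|lebesgue. ?G (A i) \<omega> * \<rho> \<omega>) sums (LINT \<omega>|lebesgue. ?G (\<Union>i. A i) \<omega> * \<rho> \<omega>)"
    unfolding eq by (intro sums_add sums_mult2 sums)
qed (auto simp: indicator_def of_bool_def)

lemma AE_eq_if_bool_observables:
  assumes "integrable lebesgue \<rho>" "integrable lebesgue \<rho>'"
    and eq: "\<And>(Y :: bool set) \<G> G \<Gamma>. observable Y \<G> G \<Longrightarrow> \<Gamma> \<in> \<G> \<Longrightarrow>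
      (LINT \<omega>|lebesgue. G \<Gamma> \<omega> * \<rho> \<omega>) = (LINT \<omega>|lebesgue. G \<Gamma> \<omega> * \<rho>' \<omega>)"
  shows "AE \<omega> in lebesgue. \<rho> \<omega> = \<rho>' \<omega>"
proof (rule density_unique_real[OF assms(1,2)])
  fix E :: "real set" assume "E \<in> sets lebesgue"
  \<comment> \<open>The outcome \<open>True\<close> has the indicator of \<open>E\<close> as its
    effect, and integrals over all Lebesgue sets determine an L^1 function almost
    everywhere.\<close>
  from eq[OF bool_observable[OF this], of "{True}"]
  show "set_lebesgue_integral lebesgue E \<rho> = set_lebesgue_integral lebesgue E \<rho>'"
    by (simp add: set_lebesgue_integral_def)
qed

lemma ess_bounded_observable:
  assumes "observable Y \<G> G" "\<Gamma> \<in> \<G>"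
  shows "ess_bounded (G \<Gamma>)" "AE \<omega> in lebesgue. 0 \<le> G \<Gamma> \<omega> \<and> G \<Gamma> \<omega> \<le> 1"
proof -
  have "G \<Gamma> \<in> borel_measurable lebesgue" and ae: "AE \<omega> in lebesgue. 0 \<le> G \<Gamma> \<omega> \<and> G \<Gamma> \<omega> \<le> 1"
    using assms by (auto simp: observable_def)
  moreover from ae have "AE \<omega> in lebesgue. \<bar>G \<Gamma> \<omega>\<bar> \<le> 1" by eventually_elim auto
  ultimately show "ess_bounded (G \<Gamma>)" by (auto simp: ess_bounded_def)
  show "AE \<omega> in lebesgue. 0 \<le> G \<Gamma> \<omega> \<and> G \<Gamma> \<omega> \<le> 1" by (rule ae)
qed

section \<open>The posterior state\<close>

lemma integrable_posterior:
  assumes "integrable lebesgue \<rho>" "s \<le> n"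
    and "\<And>i. 1 \<le> i \<Longrightarrow> i \<le> n \<Longrightarrow> r i > 0" and "\<And>i. i \<le> n \<Longrightarrow> ess_bounded (g i)"
  shows "integrable lebesgue (\<lambda>\<omega>. propagate a b r g \<rho> s \<omega> * realize n (gauss_causal a b r) g s \<omega>)"
  using assms by (intro integrable_mult_ess_bounded integrable_propagate ess_bounded_realize) auto

text \<open>By duality the mass equals the pairing at time 0, where state and realization are both
  strictly positive; for the propagated state only nonnegativity is established.\<close>

lemma mass_posterior_pos:
  assumes "integrable lebesgue \<rho>" "\<And>\<omega>. 0 < \<rho> \<omega>" "s \<le> n"
    and r: "\<And>i. 1 \<le> i \<Longrightarrow> i \<le> n \<Longrightarrow> r i > 0"
    and g: "\<And>i. i \<le> n \<Longrightarrow> ess_bounded (g i)" "\<And>i \<omega>. i \<le> n \<Longrightarrow> 0 < g i \<omega>"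
  shows "0 < (LINT \<omega>|lebesgue. propagate a b r g \<rho> s \<omega> * realize n (gauss_causal a b r) g s \<omega>)"
proof -
  have "0 < (LINT \<omega>|lebesgue. \<rho> \<omega> * realize n (gauss_causal a b r) g 0 \<omega>)"
    using assms
    by (intro lebesgue_integral_pos integrable_mult_ess_bounded ess_bounded_realize mult_pos_pos realize_pos) auto
  then show ?thesis
    using realize_duality[OF assms(1,3) r g(1), where a = a and b = b] by (simp add: mult.commute)
qed

lemma mixed_state_posterior:
  fixes a b r :: "nat \<Rightarrow> real"
  assumes "integrable lebesgue \<rho>" "\<And>\<omega>. 0 < \<rho> \<omega>" "s \<le> n"
    and r: "\<And>i. 1 \<le> i \<Longrightarrow> i \<le> n \<Longrightarrow> r i > 0"
    and g: "\<And>i. i \<le> n \<Longrightarrow> ess_bounded (g i)" "\<And>i \<omega>. i \<le> n \<Longrightarrow> 0 < g i \<omega>"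
  defines "K \<equiv> \<lambda>\<omega>. propagate a b r g \<rho> s \<omega> * realize n (gauss_causal a b r) g s \<omega>"
  shows "mixed_state (\<lambda>\<omega>. K \<omega> / (LINT \<omega>'|lebesgue. K \<omega>'))"
proof -
  have "0 < (LINT \<omega>|lebesgue. K \<omega>)"
    unfolding K_def by (rule mass_posterior_pos) (use assms in auto)
  moreover have "integrable lebesgue K"
    unfolding K_def by (rule integrable_posterior) (use assms in auto)
  moreover have "0 \<le> K \<omega>" for \<omega>
    unfolding K_def
  proof (rule mult_nonneg_nonneg)
    show "0 \<le> propagate a b r g \<rho> s \<omega>"
      using assms(2,3) g(2) by (intro propagate_nonneg) (auto intro!: less_imp_le)
    show "0 \<le> realize n (gauss_causal a b r) g s \<omega>"
      using assms by (intro less_imp_le[OF realize_pos]) auto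
  qed
  ultimately show ?thesis
    unfolding mixed_state_def by (auto simp: divide_nonneg_nonneg)
qed

lemma bayes_ratio_eq:
  fixes a b r :: "nat \<Rightarrow> real"
  assumes \<rho>: "integrable lebesgue \<rho>" and s: "s \<le> n"
    and r: "\<And>i. 1 \<le> i \<Longrightarrow> i \<le> n \<Longrightarrow> r i > 0"
    and F: "\<And>i. i \<le> n \<Longrightarrow> ess_bounded (F i (\<Xi> i))" and h: "ess_bounded h"
  defines "K \<equiv> \<lambda>\<omega>. propagate a b r (\<lambda>i. F i (\<Xi> i)) \<rho> s \<omega> * realize n (gauss_causal a b r) (\<lambda>i. F i (\<Xi> i)) s \<omega>"
  shows "bayes_ratio n F (gauss_causal a b r) s \<rho> h \<Xi> =
    (LINT \<omega>|lebesgue. h \<omega> * (K \<omega> / (LINT \<omega>'|lebesgue. K \<omega>')))"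
proof -
  have "bayes_ratio n F (gauss_causal a b r) s \<rho> h \<Xi> = (LINT \<omega>|lebesgue. h \<omega> * K \<omega>) / (LINT \<omega>|lebesgue. K \<omega>)"
    unfolding bayes_ratio_def H_hat0_def F_hat0_def K_def
    by (intro arg_cong2[where f = "(/)"] realize_duality_effect[where g = "\<lambda>i. F i (\<Xi> i)"]
        realize_duality[where g = "\<lambda>i. F i (\<Xi> i)"] \<rho> s r F h)
  then show ?thesis by (simp add: divide_inverse mult.assoc[symmetric])
qed

lemma tendsto_bayes_ratio:
  fixes a b c d q r x :: "nat \<Rightarrow> real" and \<mu> \<sigma> :: real
  assumes \<sigma>: "\<sigma> > 0" and q: "\<And>i. i \<le> n \<Longrightarrow> q i > 0" and s: "s \<le> n"
    and r: "\<And>i. 1 \<le> i \<Longrightarrow> i \<le> n \<Longrightarrow> r i > 0"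
    and h: "ess_bounded h" "AE \<omega> in lebesgue. 0 \<le> h \<omega> \<and> h \<omega> \<le> 1"
  defines "l \<equiv> \<lambda>i \<omega>. normal_density (c i * \<omega> + d i) (q i) (x i)"
  defines "K \<equiv> \<lambda>\<omega>. propagate a b r l (normal_density \<mu> \<sigma>) s \<omega> * realize n (gauss_causal a b r) l s \<omega>"
  shows "(bayes_ratio n (gauss_obs c d q) (gauss_causal a b r) s (normal_density \<mu> \<sigma>) h \<longlongrightarrow>
    (LINT \<omega>|lebesgue. h \<omega> * (K \<omega> / (LINT \<omega>'|lebesgue. K \<omega>')))) (shrinking_intervals n x)"
proof -
  let ?\<Phi> = "gauss_causal a b r" and ?\<rho> = "normal_density \<mu> \<sigma>" and ?F = "shrinking_intervals n x"
  define I where "I g = (LINT \<omega>|lebesgue. realize n ?\<Phi> g 0 \<omega> * ?\<rho> \<omega>)" for g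
  define upd where "upd g f = g(s := \<lambda>\<omega>. g s \<omega> * f \<omega>)" for g :: "nat \<Rightarrow> real \<Rightarrow> real" and f :: "real \<Rightarrow> real"
  define w where "w \<Xi> i = gauss_obs c d q i (\<Xi> i)" for \<Xi> i
  \<comment> \<open>The weights \<open>w\<close> tend to 0 with the lengths of the intervals;
    rescaled, they have the nonzero limit \<open>l\<close>.\<close>
  define w' where "w' \<Xi> i \<omega> = inverse (measure lebesgue (\<Xi> i)) * w \<Xi> i \<omega>" for \<Xi> i \<omega>
  \<comment> \<open>an effect is bounded only almost everywhere, uniform convergence needs an actual bound\<close>
  define h' where "h' \<omega> = max 0 (min 1 (h \<omega>))" for \<omega>
  have \<rho>: "integrable lebesgue ?\<rho>" using \<sigma> by (rule has_integral_gauss_kernel)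
  have [measurable]: "h \<in> borel_measurable lebesgue" using h(1) by (simp add: ess_bounded_def)
  have h'm [measurable]: "h' \<in> borel_measurable lebesgue" unfolding h'_def by measurable
  have h'_le: "\<bar>h' \<omega>\<bar> \<le> 1" for \<omega> by (auto simp: h'_def)
  have h': "ess_bounded h'" by (rule ess_boundedI[OF h'm h'_le])
  have hh': "AE \<omega> in lebesgue. h \<omega> = h' \<omega>" using h(2) by eventually_elim (auto simp: h'_def)
  have bl': "bounded (range h')" using h'_le by (auto simp: bounded_iff)
  \<comment> \<open>Duality puts the effect into a single integral against an integrable function at
    time \<open>s\<close>, where a change on a null set is invisible.\<close>
  have I_eq: "I (upd g h) = I (upd g h')" if g: "\<And>i. i \<le> n \<Longrightarrow> ess_bounded (g i)" for g
  proof -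
    let ?k = "\<lambda>\<omega>. propagate a b r g ?\<rho> s \<omega> * realize n ?\<Phi> g s \<omega>"
    have k: "integrable lebesgue ?k"
      using \<rho> s r g by (rule integrable_posterior)
    have "(LINT \<omega>|lebesgue. h \<omega> * ?k \<omega>) = (LINT \<omega>|lebesgue. h' \<omega> * ?k \<omega>)"
    proof (rule integral_cong_AE)
      show "AE \<omega> in lebesgue. h \<omega> * ?k \<omega> = h' \<omega> * ?k \<omega>"
        using hh' by eventually_elim simp
    qed (use borel_measurable_integrable[OF k] in measurable)
    moreover have "I (upd g f) = (LINT \<omega>|lebesgue. f \<omega> * ?k \<omega>)" if "ess_bounded f" for f
      unfolding I_def upd_def using \<rho> s r g that by (rule realize_duality_effect)
    ultimately show ?thesis using h(1) h' by simp
  qed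
  have lm: "l i \<in> borel_measurable lebesgue" for i unfolding l_def by measurable
  have lb: "bounded (range (l i))" for i
    using normal_density_le by (force simp: l_def bounded_iff)
  have lpos: "0 < l i \<omega>" if "i \<le> n" for i \<omega>
    using q[OF that] by (auto simp: l_def normal_density_pos)
  have le: "ess_bounded (l i)" for i
    using normal_density_le by (intro ess_boundedI[OF lm, of _ "normal_density 0 (q i) 0"]) (auto simp: l_def)
  have lim: "uniform_limit UNIV (\<lambda>\<Xi>. w' \<Xi> i) (l i) ?F" if "i \<le> n" for i
    using uniform_limit_gauss_obs[where q = q and t = i, OF q[OF that] that, of c d x]
    by (simp add: w'_def[abs_def] w_def l_def divide_inverse mult.commute)
  \<comment> \<open>\<open>measure\<close> is 0 on sets of infinite length; the bound 1 on the
    lengths lets positive \<open>emeasure\<close> yield positive \<open>measure\<close>.\<close>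
  have ev: "\<forall>\<^sub>F \<Xi> in ?F. \<forall>i\<le>n. \<Xi> i \<in> sets lebesgue \<and> 0 < measure lebesgue (\<Xi> i)"
    unfolding eventually_shrinking_intervals
  proof (intro exI[of _ 1] conjI allI impI)
    fix \<Xi> i assume "\<forall>t\<le>n. is_interval (\<Xi> t) \<and> x t \<in> \<Xi> t \<and> 0 < emeasure lebesgue (\<Xi> t) \<and> emeasure lebesgue (\<Xi> t) < ennreal 1" "i \<le> n"
    then have "is_interval (\<Xi> i)" "0 < emeasure lebesgue (\<Xi> i)" "emeasure lebesgue (\<Xi> i) < ennreal 1" by auto
    moreover from this have "emeasure lebesgue (\<Xi> i) < top" using less_trans[OF _ ennreal_less_top] by blast
    ultimately show "\<Xi> i \<in> sets lebesgue" "0 < measure lebesgue (\<Xi> i)"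
      using real_interval_borel_measurable[of "\<Xi> i"] by (simp_all add: measure_def enn2real_positive_iff)
  qed simp
  have ev_m: "\<forall>\<^sub>F \<Xi> in ?F. \<forall>i\<le>n. w' \<Xi> i \<in> borel_measurable lebesgue"
    using ev
  proof eventually_elim
    case (elim \<Xi>)
    have "w \<Xi> i \<in> borel_measurable lebesgue" if "i \<le> n" for i
      unfolding w_def using elim that ess_bounded_gauss_obs[where q=q and t=i, OF q[OF that], of "\<Xi> i" c d] by (simp add: ess_bounded_def)
    then show ?case by (auto simp: w'_def[abs_def])
  qed
  have "((\<lambda>\<Xi>. I (w' \<Xi>)) \<longlongrightarrow> I l) ?F"
    unfolding I_def using r \<sigma> lim ev_m lm lb by (rule tendsto_realize)
  moreover have "((\<lambda>\<Xi>. I (upd (w' \<Xi>) h')) \<longlongrightarrow> I (upd l h')) ?F"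
    unfolding I_def
  proof (rule tendsto_realize)
    show "r i > 0" if "1 \<le> i" "i \<le> n" for i using r that .
    show "\<sigma> > 0" by (rule \<sigma>)
    show "\<forall>\<^sub>F \<Xi> in ?F. \<forall>i\<le>n. upd (w' \<Xi>) h' i \<in> borel_measurable lebesgue"
      using ev_m by eventually_elim (use h'm s in \<open>auto simp: upd_def intro!: borel_measurable_times\<close>)
    fix i assume i: "i \<le> n"
    have "uniform_limit UNIV (\<lambda>\<Xi> \<omega>. w' \<Xi> s \<omega> * h' \<omega>) (\<lambda>\<omega>. l s \<omega> * h' \<omega>) ?F"
      by (intro uniform_lim_mult lim s uniform_limit_const lb bl')
    then show "uniform_limit UNIV (\<lambda>\<Xi>. upd (w' \<Xi>) h' i) (upd l h' i) ?F"
      using lim[OF i] by (simp add: upd_def)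
    have "bounded (range (\<lambda>\<omega>. l s \<omega> * h' \<omega>))"
      using lb[of s] h'_le unfolding bounded_iff
      by (auto simp: abs_mult) (metis abs_ge_zero mult.right_neutral mult_mono' )
    then show "bounded (range (upd l h' i))" using lb by (simp add: upd_def)
    show "upd l h' i \<in> borel_measurable lebesgue" using lm h'm by (simp add: upd_def)
  qed
  moreover have Kl: "I l = (LINT \<omega>|lebesgue. K \<omega>)"
    unfolding I_def K_def using \<rho> s r le by (rule realize_duality)
  \<comment> \<open>The limit of the rescaled denominators is not 0, so the quotient may be taken in
    the limit.\<close>
  moreover have "0 < (LINT \<omega>|lebesgue. K \<omega>)"
    unfolding K_def using \<rho> normal_density_pos[OF \<sigma>] s r le lpos by (rule mass_posterior_pos)
  ultimately have "((\<lambda>\<Xi>. I (upd (w' \<Xi>) h') / I (w' \<Xi>)) \<longlongrightarrow> I (upd l h') / I l) ?F"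
    by (intro tendsto_divide) auto
  moreover have "I (upd l h') / I l = (LINT \<omega>|lebesgue. h \<omega> * (K \<omega> / (LINT \<omega>'|lebesgue. K \<omega>')))"
  proof -
    have "I (upd l h') = (LINT \<omega>|lebesgue. h \<omega> * K \<omega>)"
      unfolding I_eq[OF le, symmetric] unfolding I_def upd_def K_def
      using \<rho> s r le h(1) by (rule realize_duality_effect)
    then show ?thesis by (simp add: Kl divide_inverse mult.assoc[symmetric])
  qed
  moreover have "\<forall>\<^sub>F \<Xi> in ?F. I (upd (w' \<Xi>) h') / I (w' \<Xi>) = bayes_ratio n (gauss_obs c d q) ?\<Phi> s ?\<rho> h \<Xi>"
    using ev
  proof eventually_elim
    case (elim \<Xi>)
    \<comment> \<open>Rescaling multiplies numerator and denominator by the same nonzero product of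
      inverse lengths, which cancels.\<close>
    define k where "k = (\<Prod>i=0..n. inverse (measure lebesgue (\<Xi> i)))"
    have "k \<noteq> 0" using elim by (fastforce simp: k_def)
    have scale: "I (\<lambda>i \<omega>. inverse (measure lebesgue (\<Xi> i)) * g i \<omega>) = k * I g" for g
      unfolding I_def k_def by (simp add: realize_scale mult.assoc)
    have "upd (w' \<Xi>) h' = (\<lambda>i \<omega>. inverse (measure lebesgue (\<Xi> i)) * upd (w \<Xi>) h' i \<omega>)"
      by (auto simp: upd_def w'_def fun_eq_iff)
    then have 1: "I (upd (w' \<Xi>) h') = k * I (upd (w \<Xi>) h')" by (simp add: scale)
    have 2: "I (w' \<Xi>) = k * I (w \<Xi>)"
      unfolding scale[symmetric] by (simp add: w'_def[abs_def])
    have "ess_bounded (w \<Xi> i)" if "i \<le> n" for i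
      unfolding w_def using elim that by (intro ess_bounded_gauss_obs q) auto
    then have 3: "I (upd (w \<Xi>) h') = I (upd (w \<Xi>) h)" by (rule I_eq[symmetric])
    show ?case
      using \<open>k \<noteq> 0\<close> unfolding 1 2 3 bayes_ratio_def H_hat0_def F_hat0_def
      by (simp add: I_def upd_def w_def[abs_def])
  qed
  ultimately show ?thesis by (simp add: tendsto_cong)
qed

text \<open>Strict positivity of the effects gives the rectangle positive probability, so that
  \<open>K\<close> can be normalised. The observables may be arbitrary here; only the causal
  operators are Gaussian.\<close>

lemma has_bayes_kalman_posterior:
  fixes a b r :: "nat \<Rightarrow> real"
  assumes \<rho>: "integrable lebesgue \<rho>" "\<And>\<omega>. 0 < \<rho> \<omega>" and s: "s \<le> n"
    and r: "\<And>i. 1 \<le> i \<Longrightarrow> i \<le> n \<Longrightarrow> r i > 0"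
    and \<Xi>: "\<And>i. i \<le> n \<Longrightarrow> \<Xi> i \<in> sets borel"
    and F: "\<And>i. i \<le> n \<Longrightarrow> ess_bounded (F i (\<Xi> i))" "\<And>i \<omega>. i \<le> n \<Longrightarrow> 0 < F i (\<Xi> i) \<omega>"
  defines "K \<equiv> \<lambda>\<omega>. propagate a b r (\<lambda>i. F i (\<Xi> i)) \<rho> s \<omega> * realize n (gauss_causal a b r) (\<lambda>i. F i (\<Xi> i)) s \<omega>"
  shows "has_bayes_kalman TYPE('y) n F (gauss_causal a b r) s \<rho> \<Xi> (\<lambda>\<omega>. K \<omega> / (LINT \<omega>'|lebesgue. K \<omega>'))"
  unfolding has_bayes_kalman_def
proof (intro conjI allI impI)
  let ?\<rho> = "\<lambda>\<omega>. K \<omega> / (LINT \<omega>'|lebesgue. K \<omega>')"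
  have ms: "mixed_state ?\<rho>"
    unfolding K_def using \<rho> s r F by (rule mixed_state_posterior)
  have eq: "bayes_ratio n F (gauss_causal a b r) s \<rho> h \<Xi> = (LINT \<omega>|lebesgue. h \<omega> * ?\<rho> \<omega>)" if "ess_bounded h" for h
    unfolding K_def using \<rho>(1) s r F(1) that by (rule bayes_ratio_eq)
  show "\<Xi> t \<in> sets borel" if "t \<le> n" for t using \<Xi> that .
  have "0 < (LINT \<omega>|lebesgue. K \<omega>)"
    unfolding K_def using \<rho> s r F by (rule mass_posterior_pos)
  also have "(LINT \<omega>|lebesgue. K \<omega>) = (LINT \<omega>|lebesgue. F_hat0 n F (gauss_causal a b r) \<Xi> \<omega> * \<rho> \<omega>)"
    unfolding F_hat0_def K_def using \<rho>(1) s r F(1) by (rule realize_duality[symmetric])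
  finally show "0 < (LINT \<omega>|lebesgue. F_hat0 n F (gauss_causal a b r) \<Xi> \<omega> * \<rho> \<omega>)" .
  show "bayes_kalman_eq TYPE('y) n F (gauss_causal a b r) s \<rho> \<Xi> ?\<rho>"
    unfolding bayes_kalman_eq_def using ms eq ess_bounded_observable(1) by blast
  fix \<rho>' assume \<rho>': "bayes_kalman_eq TYPE(bool) n F (gauss_causal a b r) s \<rho> \<Xi> \<rho>'"
  show "AE \<omega> in lebesgue. \<rho>' \<omega> = ?\<rho> \<omega>"
  proof (rule AE_eq_if_bool_observables)
    show "integrable lebesgue \<rho>'" using \<rho>' by (simp add: bayes_kalman_eq_def mixed_state_def)
    show "integrable lebesgue ?\<rho>" using ms by (simp add: mixed_state_def)
    fix Y :: "bool set" and \<G> G \<Gamma> assume G: "observable Y \<G> G" "\<Gamma> \<in> \<G>"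
    then have "bayes_ratio n F (gauss_causal a b r) s \<rho> (G \<Gamma>) \<Xi> = (LINT \<omega>|lebesgue. G \<Gamma> \<omega> * \<rho>' \<omega>)"
      using \<rho>' unfolding bayes_kalman_eq_def by blast
    with eq[OF ess_bounded_observable(1)[OF G]]
    show "(LINT \<omega>|lebesgue. G \<Gamma> \<omega> * \<rho>' \<omega>) = (LINT \<omega>|lebesgue. G \<Gamma> \<omega> * ?\<rho> \<omega>)" by simp
  qed
qed

theorem mainTheorem1:
  fixes n s :: nat
    and \<mu>0 \<sigma>0 :: real
    and c d q a b r :: "nat \<Rightarrow> real"
    and x :: "nat \<Rightarrow> real"
  assumes "n \<ge> 1"
    and "\<sigma>0 > 0"
    and "\<And>t. t \<le> n \<Longrightarrow> q t > 0"
    and "\<And>t. 1 \<le> t \<Longrightarrow> t \<le> n \<Longrightarrow> r t > 0"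
    and "s \<le> n"
  shows "has_bayes_kalman_at TYPE('y) n (gauss_obs c d q) (gauss_causal a b r) s
           (normal_density \<mu>0 \<sigma>0) x
           (\<lambda>\<omega>. backward_likelihood n c d q a b r x s \<omega> * forward_density \<mu>0 \<sigma>0 c d q a b r x s \<omega> /
                (LINT \<omega>'|lebesgue. backward_likelihood n c d q a b r x s \<omega>' *
                                   forward_density \<mu>0 \<sigma>0 c d q a b r x s \<omega>'))"
proof -
  let ?\<Phi> = "gauss_causal a b r" and ?init = "normal_density \<mu>0 \<sigma>0" and ?F = "gauss_obs c d q"
  let ?B = "backward_likelihood n c d q a b r x s" and ?A = "forward_density \<mu>0 \<sigma>0 c d q a b r x s"
  let ?\<rho> = "\<lambda>\<omega>. ?B \<omega> * ?A \<omega> / (LINT \<omega>'|lebesgue. ?B \<omega>' * ?A \<omega>')"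
  define l where "l i \<omega> = normal_density (c i * \<omega> + d i) (q i) (x i)" for i \<omega>
  define K where "K \<omega> = propagate a b r l ?init s \<omega> * realize n ?\<Phi> l s \<omega>" for \<omega>
  have \<rho>0: "integrable lebesgue ?init" "\<And>\<omega>. 0 < ?init \<omega>"
    using has_integral_gauss_kernel(1) normal_density_pos assms(2) by auto
  have l_eq: "l = (\<lambda>i \<omega>. normal_density (c i * \<omega> + d i) (q i) (x i))"
    by (simp add: l_def fun_eq_iff)
  have "\<exists>k>0. propagate a b r l ?init s = (\<lambda>\<omega>. k * ?A \<omega>)"
    unfolding l_eq using assms(2,5,3,4) by (rule propagate_gauss[THEN conjunct2])
  then obtain k where k: "k > 0" "propagate a b r l ?init s = (\<lambda>\<omega>. k * ?A \<omega>)" by blast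
  have "\<exists>k>0. realize n ?\<Phi> l s = (\<lambda>\<omega>. k * ?B \<omega>)"
    unfolding l_eq using assms(5,3,4) by (rule realize_gauss)
  then obtain k' where k': "k' > 0" "realize n ?\<Phi> l s = (\<lambda>\<omega>. k' * ?B \<omega>)" by blast
  have K: "K = (\<lambda>\<omega>. k * k' * (?B \<omega> * ?A \<omega>))"
    by (simp add: K_def k(2) k'(2) fun_eq_iff)
  \<comment> \<open>Normalisation absorbs \<open>k\<close> and \<open>k'\<close>, so both recursions
    need to be right only up to positive factors.\<close>
  have \<rho>_eq: "?\<rho> = (\<lambda>\<omega>. K \<omega> / (LINT \<omega>'|lebesgue. K \<omega>'))"
  proof -
    have "k * k' \<noteq> 0" using k(1) k'(1) by simp
    from mult_divide_mult_cancel_left[OF this] show ?thesis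
      by (simp only: K integral_mult_right_zero)
  qed
  have l: "ess_bounded (l i)" for i
    using normal_density_le by (intro ess_boundedI[where C = "normal_density 0 (q i) 0"]) (auto simp: l_eq)
  have "0 < l i \<omega>" if "i \<le> n" for i \<omega>
    using assms(3)[OF that] by (simp add: l_def normal_density_pos)
  with \<rho>0 assms(5,4) l have ms: "mixed_state ?\<rho>"
    unfolding \<rho>_eq K_def by (rule mixed_state_posterior)
  have lim: "(bayes_ratio n ?F ?\<Phi> s ?init h \<longlongrightarrow> (LINT \<omega>|lebesgue. h \<omega> * ?\<rho> \<omega>)) (shrinking_intervals n x)"
    if "ess_bounded h" "AE \<omega> in lebesgue. 0 \<le> h \<omega> \<and> h \<omega> \<le> 1" for h
  proof -
    have "(bayes_ratio n ?F ?\<Phi> s ?init h \<longlongrightarrow> (LINT \<omega>|lebesgue. h \<omega> * (K \<omega> / (LINT \<omega>'|lebesgue. K \<omega>'))))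
        (shrinking_intervals n x)"
      unfolding K_def l_eq using assms(2,3,5,4) that by (rule tendsto_bayes_ratio)
    then show ?thesis by (simp only: fun_cong[OF \<rho>_eq])
  qed
  show ?thesis
    unfolding has_bayes_kalman_at_def
  proof (intro conjI allI impI)
    show "\<forall>\<^sub>F \<Xi> in shrinking_intervals n x. \<exists>\<rho>\<^sub>\<Xi>. has_bayes_kalman TYPE('y) n ?F ?\<Phi> s ?init \<Xi> \<rho>\<^sub>\<Xi>"
      unfolding eventually_shrinking_intervals
    \<comment> \<open>The radius 1 is an arbitrary choice: the operator exists whenever all
      intervals have positive length.\<close>
    proof (intro exI[of _ 1] conjI allI impI)
      fix \<Xi> assume "\<forall>t\<le>n. is_interval (\<Xi> t) \<and> x t \<in> \<Xi> t \<and> 0 < emeasure lebesgue (\<Xi> t) \<and> emeasure lebesgue (\<Xi> t) < ennreal 1"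
      then have \<Xi>: "\<Xi> t \<in> sets borel" "0 < emeasure lebesgue (\<Xi> t)" if "t \<le> n" for t
        using that real_interval_borel_measurable by auto
      then have "ess_bounded (?F t (\<Xi> t))" "0 < ?F t (\<Xi> t) \<omega>" if "t \<le> n" for t \<omega>
        using that assms(3) by (auto intro!: ess_bounded_gauss_obs gauss_obs_pos)
      with \<rho>0 assms(5,4) \<Xi>(1) show "\<exists>\<rho>\<^sub>\<Xi>. has_bayes_kalman TYPE('y) n ?F ?\<Phi> s ?init \<Xi> \<rho>\<^sub>\<Xi>"
        by (intro exI) (rule has_bayes_kalman_posterior)
    qed simp
    show "bayes_kalman_lim TYPE('y) n ?F ?\<Phi> s ?init x ?\<rho>"
      unfolding bayes_kalman_lim_def
      by (intro conjI allI impI ballI ms lim; erule (1) ess_bounded_observable)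
    fix \<rho>' assume \<rho>': "bayes_kalman_lim TYPE(bool) n ?F ?\<Phi> s ?init x \<rho>'"
    show "AE \<omega> in lebesgue. \<rho>' \<omega> = ?\<rho> \<omega>"
    proof (rule AE_eq_if_bool_observables)
      show "integrable lebesgue \<rho>'" using \<rho>' by (simp add: bayes_kalman_lim_def mixed_state_def)
      show "integrable lebesgue ?\<rho>" using ms by (simp add: mixed_state_def)
      fix Y :: "bool set" and \<G> G \<Gamma> assume G: "observable Y \<G> G" "\<Gamma> \<in> \<G>"
      then have "(bayes_ratio n ?F ?\<Phi> s ?init (G \<Gamma>) \<longlongrightarrow> (LINT \<omega>|lebesgue. G \<Gamma> \<omega> * \<rho>' \<omega>)) (shrinking_intervals n x)"
        using \<rho>' unfolding bayes_kalman_lim_def by blast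
      \<comment> \<open>Both integrals are limits of the same Bayes ratio along a non-trivial
        filter.\<close>
      from tendsto_unique[OF shrinking_intervals_neq_bot this lim[OF ess_bounded_observable[OF G]]]
      show "(LINT \<omega>|lebesgue. G \<Gamma> \<omega> * \<rho>' \<omega>) = (LINT \<omega>|lebesgue. G \<Gamma> \<omega> * ?\<rho> \<omega>)" .
    qed
  qed
qed

end
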